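(* Let $\ell_1\le\ell_2\le\cdots$ be real numbers for which there is a constant $\bar c>0$ with $\log n\le\ell_n\le\bar c\sqrt{n/\log n}$ for all $n>1$. Let $(\alpha_n)$ be real numbers such that (i) $\alpha_n=o(n)$ as $n\to\infty$; (ii) $\xi_n:=\alpha_n/\ell_n^2\to\infty$ as $n\to\infty$; (iii) for all sufficiently large $n$, $\frac{16n}{(\log\xi_n)^{3/2}}<\alpha_n$. Then $E(U_n)\ge n-O(\alpha_n)$ as $n\to\infty$.
   Context: Random model: $\mathcal Q_n$ is an $\ell_n\times\ell_n$ square in $\mathbb{R}^2$; points $V_1,\dots,V_n$ are chosen independently and uniformly at random from $\mathcal Q_n$, and $\mathcal G_n$ is the unit disk graph on these points: $V_i,V_j$ are adjacent iff their Euclidean distance is less than $1$. Vertex $V_i$ has ID $i$. For a vertex $v_i$, $\mathcal N(v_i)$ is the set consisting of $v_i$ and all vertices adjacent to it. Rule 2: vertex $v_i$ is excluded (becomes a non-gateway) iff $\mathcal N(v_i)$ contains two vertices $v_{i_1},v_{i_2}$ with $i_1>i_2>i$, $\mathcal N(v_i)\subseteq\mathcal N(v_{i_1})\cup\mathcal N(v_{i_2})$, and $v_{i_1}$ adjacent to $v_{i_2}$; the non-excluded vertices form the Rule 2 dominating set. $U_n$ is the number of vertices of $\mathcal G_n$ excluded by Rule 2 (so $n-U_n$ is the size of the Rule 2 dominating set). *)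

theory Defs
  imports "HOL-Probability.Probability" "HOL-Library.Landau_Symbols"
begin

text \<open>The plane is \<^typ>\<open>real \<times> real\<close>, whose \<^const>\<open>dist\<close> is the Euclidean distance.
  A vertex is its ID \<open>i \<in> {1..n}\<close>, and \<open>p i\<close> is its position; vertices with
  coinciding positions are still distinct vertices.\<close>

definition udg_adj :: "(nat \<Rightarrow> real \<times> real) \<Rightarrow> nat \<Rightarrow> nat \<Rightarrow> bool" where
  "udg_adj p i j \<longleftrightarrow> i \<noteq> j \<and> dist (p i) (p j) < 1"

definition closed_nbhd :: "nat \<Rightarrow> (nat \<Rightarrow> real \<times> real) \<Rightarrow> nat \<Rightarrow> nat set" where
  "closed_nbhd n p i = insert i {j \<in> {1..n}. udg_adj p i j}"

definition rule2_excluded :: "nat \<Rightarrow> (nat \<Rightarrow> real \<times> real) \<Rightarrow> nat \<Rightarrow> bool" where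
  "rule2_excluded n p i \<longleftrightarrow>
     (\<exists>i1 \<in> closed_nbhd n p i. \<exists>i2 \<in> closed_nbhd n p i.
        i1 > i2 \<and> i2 > i \<and>
        closed_nbhd n p i \<subseteq> closed_nbhd n p i1 \<union> closed_nbhd n p i2 \<and>
        udg_adj p i1 i2)"

definition num_excluded :: "nat \<Rightarrow> (nat \<Rightarrow> real \<times> real) \<Rightarrow> nat" where
  "num_excluded n p = card {i \<in> {1..n}. rule2_excluded n p i}"

definition square :: "real \<Rightarrow> (real \<times> real) set" where
  "square l = {0..l} \<times> {0..l}"

definition iid_uniform_points ::
    "'a measure \<Rightarrow> nat \<Rightarrow> real \<Rightarrow> (nat \<Rightarrow> 'a \<Rightarrow> real \<times> real) \<Rightarrow> bool" where
  "iid_uniform_points M n l V \<longleftrightarrow>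
     prob_space M \<and>
     prob_space.indep_vars M (\<lambda>_. borel) V {1..n} \<and>
     (\<forall>i \<in> {1..n}. distr M borel (V i) = uniform_measure lborel (square l))"

end

theory Submission
  imports Defs "HOL-Real_Asymp.Real_Asymp"
begin

text \<open>
  Write \<open>\<epsilon> = \<alpha> / n\<close> and let \<open>h\<close> be \<open>\<alpha>\<close> rounded up. The last \<open>2h\<close> vertices cost only \<open>O(\<alpha>)\<close>, so it suffices
  that every other vertex survives with probability \<open>O(\<epsilon>)\<close>. Such a vertex at \<open>x\<close> is excluded as soon as two of
  the last \<open>2h\<close> vertices lie at distance about \<open>r\<close> on opposite sides of \<open>x\<close>, in directions that agree up to an
  angle \<open>O(r)\<close>, and no vertex falls into the part of the unit disk around \<open>x\<close> that they leave uncovered,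
  which has area \<open>O(r\<^sup>3)\<close>. One direction is rarely occupied on both sides, but a number of directions that is
  polynomial in \<open>1 / \<epsilon>\<close> contains an occupied one with probability \<open>1 - O(\<epsilon>)\<close>, and the union bound over
  these directions for the uncovered part to be hit still gives \<open>O(\<epsilon>)\<close>. That many directions are available
  because hypothesis (iii) makes \<open>1 / \<epsilon>\<close> at most polylogarithmic in \<open>\<xi>\<close>, whereas \<open>1 / r\<close> is at least a power
  of \<open>\<xi>\<close>.
\<close>

subsection \<open>Independent points hitting paired targets\<close>

lemma (in prob_space) measure_PiM_Collect:
  assumes "finite J" "K \<subseteq> J" "\<And>i. i \<in> K \<Longrightarrow> X i \<in> events"
  shows "measure (PiM J (\<lambda>_. M)) {x \<in> space (PiM J (\<lambda>_. M)). \<forall>i\<in>K. x i \<in> X i} = (\<Prod>i\<in>K. prob (X i))"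
proof -
  interpret P: product_prob_space "\<lambda>_. M" J
    by (intro product_prob_spaceI) (rule prob_space_axioms)
  have "emeasure (PiM J (\<lambda>_. M)) {x \<in> space (PiM J (\<lambda>_. M)). \<forall>i\<in>K. x i \<in> X i} = (\<Prod>i\<in>K. emeasure M (X i))"
    using assms by (intro P.emeasure_PiM_Collect) (auto intro: finite_subset)
  then show ?thesis
    unfolding P.emeasure_eq_measure emeasure_eq_measure
    by (simp add: prod_ennreal measure_nonneg prod_nonneg)
qed

text \<open>By independence the probability is \<open>(1 - prob A) ^ card H\<close>, and
  \<open>1 + x \<le> exp x\<close> bounds each factor by \<open>exp (- q)\<close>.\<close>

lemma (in prob_space) measure_PiM_avoid_le:
  fixes q :: real
  assumes "finite J" "H \<subseteq> J" "A \<in> events" "q \<le> prob A"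
  shows "measure (PiM J (\<lambda>_. M)) {x \<in> space (PiM J (\<lambda>_. M)). \<forall>j\<in>H. x j \<notin> A} \<le> exp (- (card H * q))"
proof -
  have "{x \<in> space (PiM J (\<lambda>_. M)). \<forall>j\<in>H. x j \<notin> A}
      = {x \<in> space (PiM J (\<lambda>_. M)). \<forall>j\<in>H. x j \<in> space M - A}"
    using assms(2) by (auto simp: space_PiM PiE_def Pi_iff)
  then have "measure (PiM J (\<lambda>_. M)) {x \<in> space (PiM J (\<lambda>_. M)). \<forall>j\<in>H. x j \<notin> A} = (\<Prod>j\<in>H. prob (space M - A))"
    using measure_PiM_Collect[OF assms(1,2), of "\<lambda>_. space M - A"] assms(3) by simp
  also have "\<dots> = (1 - prob A) ^ card H"
    using assms by (simp add: prob_compl)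
  also have "\<dots> \<le> exp (- q) ^ card H"
    using assms(4) exp_ge_add_one_self[of "- prob A"] 
    by (intro power_mono) (auto intro: order_trans)
  also have "\<dots> = exp (- (card H * q))"
    by (simp add: exp_of_nat_mult[symmetric])
  finally show ?thesis .
qed

lemma (in prob_space) indep_vars_PiM_coordinates:
  assumes "finite J" "J \<noteq> {}"
  shows "prob_space.indep_vars (PiM J (\<lambda>_. M)) (\<lambda>_. M) (\<lambda>j x. x j) J"
proof -
  interpret P: product_prob_space "\<lambda>_. M" J
    by (intro product_prob_spaceI) (rule prob_space_axioms)
  have "distr (PiM J (\<lambda>_. M)) (PiM J (\<lambda>_. M)) (\<lambda>x. \<lambda>i\<in>J. x i) = PiM J (\<lambda>_. M)"
    by (rule distr_cong[THEN trans, OF refl refl _ distr_id])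
       (auto simp: space_PiM intro: PiE_restrict)
  also have "\<dots> = PiM J (\<lambda>i. distr (PiM J (\<lambda>_. M)) M (\<lambda>x. x i))"
    by (intro PiM_cong refl) (simp add: P.PiM_component)
  finally show ?thesis
    using assms by (subst P.indep_vars_iff_distr_eq_PiM') auto
qed

text \<open>Makes it possible to fix what the points of one block have done before looking at those
  of the other block. Stating the events through \<open>restrict\<close> records that each depends
  on its own block only.\<close>

lemma (in prob_space) measure_PiM_indep_blocks:
  assumes "finite J" "H1 \<subseteq> J" "H2 \<subseteq> J" "H1 \<inter> H2 = {}" "J \<noteq> {}"
    and Q: "Measurable.pred (PiM H1 (\<lambda>_. M)) Q" and R: "Measurable.pred (PiM H2 (\<lambda>_. M)) R"
  shows "measure (PiM J (\<lambda>_. M)) {x \<in> space (PiM J (\<lambda>_. M)). Q (restrict x H1) \<and> R (restrict x H2)}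
    = measure (PiM J (\<lambda>_. M)) {x \<in> space (PiM J (\<lambda>_. M)). Q (restrict x H1)}
    * measure (PiM J (\<lambda>_. M)) {x \<in> space (PiM J (\<lambda>_. M)). R (restrict x H2)}"
proof -
  interpret P: product_prob_space "\<lambda>_. M" J
    by (intro product_prob_spaceI) (rule prob_space_axioms)
  have "P.indep_var (PiM H1 (\<lambda>_. M)) (\<lambda>x. restrict (\<lambda>i. x i) H1) (PiM H2 (\<lambda>_. M)) (\<lambda>x. restrict (\<lambda>i. x i) H2)"
    using assms by (intro P.indep_var_restrict[OF indep_vars_PiM_coordinates]) auto
  from P.indep_varD[OF this, of "{x \<in> space (PiM H1 (\<lambda>_. M)). Q x}" "{x \<in> space (PiM H2 (\<lambda>_. M)). R x}"] Q R
  have "measure (PiM J (\<lambda>_. M)) ((\<lambda>x. (restrict (\<lambda>i. x i) H1, restrict (\<lambda>i. x i) H2)) -`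
       ({x \<in> space (PiM H1 (\<lambda>_. M)). Q x} \<times> {x \<in> space (PiM H2 (\<lambda>_. M)). R x}) \<inter> space (PiM J (\<lambda>_. M))) =
    measure (PiM J (\<lambda>_. M)) ((\<lambda>x. restrict (\<lambda>i. x i) H1) -` {x \<in> space (PiM H1 (\<lambda>_. M)). Q x} \<inter> space (PiM J (\<lambda>_. M))) *
    measure (PiM J (\<lambda>_. M)) ((\<lambda>x. restrict (\<lambda>i. x i) H2) -` {x \<in> space (PiM H2 (\<lambda>_. M)). R x} \<inter> space (PiM J (\<lambda>_. M)))"
    by simp
  moreover have "(\<lambda>x. (restrict (\<lambda>i. x i) H1, restrict (\<lambda>i. x i) H2)) -`
       ({x \<in> space (PiM H1 (\<lambda>_. M)). Q x} \<times> {x \<in> space (PiM H2 (\<lambda>_. M)). R x}) \<inter> space (PiM J (\<lambda>_. M))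
    = {x \<in> space (PiM J (\<lambda>_. M)). Q (restrict x H1) \<and> R (restrict x H2)}"
    "(\<lambda>x. restrict (\<lambda>i. x i) H1) -` {x \<in> space (PiM H1 (\<lambda>_. M)). Q x} \<inter> space (PiM J (\<lambda>_. M))
     = {x \<in> space (PiM J (\<lambda>_. M)). Q (restrict x H1)}"
    "(\<lambda>x. restrict (\<lambda>i. x i) H2) -` {x \<in> space (PiM H2 (\<lambda>_. M)). R x} \<inter> space (PiM J (\<lambda>_. M))
     = {x \<in> space (PiM J (\<lambda>_. M)). R (restrict x H2)}"
    using assms(2,3) by (force simp: space_PiM PiE_def Pi_iff)+
  ultimately show ?thesis by simp
qed

text \<open>An element chosen from block \<open>s\<close> has quotient \<open>s\<close> on division
  by \<open>m\<close>, so choices from different blocks are different.\<close>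

lemma card_ge_if_blocks_hit:
  fixes K :: "nat set"
  assumes "finite K" "\<And>s. s < t \<Longrightarrow> \<exists>k\<in>{s*m..<s*m+m}. k \<in> K"
  shows "t \<le> card K"
proof -
  obtain c where c: "\<And>s. s < t \<Longrightarrow> c s \<in> {s*m..<s*m+m} \<and> c s \<in> K"
    using assms(2) by metis
  have "c s div m = s" if "s < t" for s
    using c[OF that] by (intro div_nat_eqI) (auto simp: algebra_simps)
  then have "inj_on c {..<t}"
    by (metis inj_onI lessThan_iff)
  then have "card {..<t} \<le> card K"
    using c assms(1) by (intro card_inj_on_le[of c]) auto
  then show ?thesis by simp
qed

text \<open>Grouping the indices \<open>k\<close> into \<open>t\<close> blocks of length \<open>m\<close> replaces a second moment
  computation: with high probability the points of \<open>H1\<close> hit some \<open>S k\<close> in every block, and then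
  the points of \<open>H2\<close> independently have at least \<open>t\<close> disjoint targets \<open>S' k\<close>.\<close>

lemma (in prob_space) prob_no_clean_pair_le:
  fixes S S' B :: "nat \<Rightarrow> 'a set" and t m :: nat and p b :: real
  assumes J: "finite J" "H1 \<subseteq> J" "H2 \<subseteq> J" "H1 \<inter> H2 = {}" "J \<noteq> {}"
    and card: "card H1 = h" "card H2 = h"
    and meas [measurable]: "\<And>k. S k \<in> events" "\<And>k. S' k \<in> events" "\<And>k. B k \<in> events"
    and disj: "disjoint_family_on S {..<t*m}" "disjoint_family_on S' {..<t*m}"
    and SB: "\<And>k. k < t*m \<Longrightarrow> S k \<inter> B k = {}" "\<And>k. k < t*m \<Longrightarrow> S' k \<inter> B k = {}"
    and p: "\<And>k. k < t*m \<Longrightarrow> prob (S k) = p" "\<And>k. k < t*m \<Longrightarrow> prob (S' k) = p"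
    and b: "\<And>k. k < t*m \<Longrightarrow> prob (B k) \<le> b" and p0: "0 \<le> p" "0 \<le> b"
  shows "measure (PiM J (\<lambda>_. M)) {x \<in> space (PiM J (\<lambda>_. M)).
      \<not> (\<exists>k<t*m. \<exists>j1\<in>H1. \<exists>j2\<in>H2. x j1 \<in> S k \<and> x j2 \<in> S' k \<and> (\<forall>j\<in>J. x j \<notin> B k))}
    \<le> t * exp (- (h * (m * p))) + exp (- (h * (t * p))) + (t*m) * (h*p)^2 * (card J * b)"
proof -
  interpret P: product_prob_space "\<lambda>_. M" J
    by (intro product_prob_spaceI) (rule prob_space_axioms)
  let ?P = "PiM J (\<lambda>_. M)"
  let ?T = "t*m"
  have fin: "finite H1" "finite H2" using J by (auto intro: finite_subset)
  \<comment> \<open>The failure event is covered by three families: \<open>E1 s\<close>, the points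
    of \<open>H1\<close> miss all of block \<open>s\<close>; \<open>E2 K\<close>, they occupy
    exactly the targets in \<open>K\<close> but \<open>H2\<close> misses every partner of these;
    \<open>E3\<close>, some pair of targets is hit on both sides but a point spoils it by lying in
    \<open>B k\<close>.\<close>
  define F where "F s = {s*m..<s*m+m}" for s
  define occ where "occ x = {k\<in>{..<?T}. \<exists>j\<in>H1. x j \<in> S k}" for x
  define E1 where "E1 s = {x \<in> space ?P. \<forall>j\<in>H1. x j \<notin> (\<Union>k\<in>F s. S k)}" for s
  define E2 where "E2 K = {x \<in> space ?P. occ x = K \<and> (\<forall>j\<in>H2. x j \<notin> (\<Union>k\<in>K. S' k))}" for K
  define E3 where "E3 = (\<lambda>(k,j1,j2,j). {x \<in> space ?P. x j1 \<in> S k \<and> x j2 \<in> S' k \<and> x j \<in> B k})"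
  define KK where "KK = {K. K \<subseteq> {..<?T} \<and> t \<le> card K}"
  define I3 where "I3 = {..<?T} \<times> H1 \<times> H2 \<times> J"
  have finKK: "finite KK" by (rule finite_subset[of _ "Pow {..<?T}"]) (auto simp: KK_def)
  have finI3: "finite I3" using fin J by (auto simp: I3_def)
  have FT: "F s \<subseteq> {..<?T}" if "s < t" for s
  proof -
    have "s*m+m \<le> t*m" using that by (metis Suc_leI add.commute mult_Suc mult_le_mono1)
    then show ?thesis by (auto simp: F_def)
  qed
  have sub: "{x \<in> space ?P. \<not> (\<exists>k<?T. \<exists>j1\<in>H1. \<exists>j2\<in>H2. x j1 \<in> S k \<and> x j2 \<in> S' k \<and> (\<forall>j\<in>J. x j \<notin> B k))}
    \<subseteq> ((\<Union>s<t. E1 s) \<union> (\<Union>K\<in>KK. E2 K)) \<union> (\<Union>i\<in>I3. E3 i)"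
  proof (intro subsetI, rule ccontr)
    fix x assume x: "x \<in> {x \<in> space ?P. \<not> (\<exists>k<?T. \<exists>j1\<in>H1. \<exists>j2\<in>H2. x j1 \<in> S k \<and> x j2 \<in> S' k \<and> (\<forall>j\<in>J. x j \<notin> B k))}"
      and n: "x \<notin> ((\<Union>s<t. E1 s) \<union> (\<Union>K\<in>KK. E2 K)) \<union> (\<Union>i\<in>I3. E3 i)"
    have "\<exists>k\<in>{s*m..<s*m+m}. k \<in> occ x" if "s < t" for s
    proof -
      have "x \<notin> E1 s" using n that by auto
      then obtain j k where "j \<in> H1" "k \<in> F s" "x j \<in> S k" using x by (auto simp: E1_def)
      then have "k \<in> occ x" using FT[OF that] by (auto simp: occ_def)
      then show ?thesis using \<open>k \<in> F s\<close> by (auto simp: F_def)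
    qed
    then have "t \<le> card (occ x)" by (intro card_ge_if_blocks_hit) (auto simp: occ_def)
    then have "occ x \<in> KK" by (auto simp: KK_def occ_def)
    then have "x \<notin> E2 (occ x)" using n by auto
    then obtain j2 k where j2: "j2 \<in> H2" "k \<in> occ x" "x j2 \<in> S' k" using x by (auto simp: E2_def)
    then obtain j1 where j1: "j1 \<in> H1" "x j1 \<in> S k" "k < ?T" by (auto simp: occ_def)
    then obtain j where j: "j \<in> J" "x j \<in> B k" using x j2 by auto
    then have "x \<in> E3 (k,j1,j2,j)" "(k,j1,j2,j) \<in> I3" using x j1 j2 by (auto simp: E3_def I3_def)
    then show False using n by blast
  qed
  have H: "j \<in> J" if "j \<in> H1 \<or> j \<in> H2" for j using that J by auto
  have at: "Measurable.pred (PiM I (\<lambda>_. M)) (\<lambda>x. x j \<in> A)" if "j \<in> I" "A \<in> events" for I j A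
  proof (rule pred_sets2[OF that(2)])
    show "(\<lambda>x. x j) \<in> measurable (PiM I (\<lambda>_. M)) M"
      using measurable_component_singleton[OF that(1), of "\<lambda>_. M"] by simp
  qed
  have mE1: "E1 s \<in> P.events" for s
  proof -
    have "Measurable.pred ?P (\<lambda>x. \<forall>j\<in>H1. \<forall>k\<in>F s. \<not> x j \<in> S k)"
      by (intro pred_intros_finite pred_intros_logic at fin meas H disjI1) (auto simp: F_def)
    from predE[OF this] show ?thesis by (simp add: E1_def)
  qed
  have pocc: "Measurable.pred ?P (\<lambda>x. occ x = K)" if "K \<in> KK" for K
  proof -
    have "Measurable.pred ?P (\<lambda>x. \<forall>k\<in>{..<?T}. (\<exists>j\<in>H1. x j \<in> S k) \<longleftrightarrow> k \<in> K)"
      by (intro pred_intros_finite pred_intros_logic at fin meas H disjI1 measurable_const) auto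
    moreover have "(\<lambda>x. occ x = K) = (\<lambda>x. \<forall>k\<in>{..<?T}. (\<exists>j\<in>H1. x j \<in> S k) \<longleftrightarrow> k \<in> K)"
      using that by (auto simp: occ_def KK_def fun_eq_iff)
    ultimately show ?thesis by simp
  qed
  have mE2: "E2 K \<in> P.events" if "K \<in> KK" for K
  proof -
    have fK: "finite K" using that finite_subset by (auto simp: KK_def)
    have "Measurable.pred ?P (\<lambda>x. occ x = K \<and> (\<forall>j\<in>H2. \<forall>k\<in>K. \<not> x j \<in> S' k))"
      by (intro pred_intros_finite pred_intros_logic pocc that at fin fK meas H disjI2)
    from predE[OF this] show ?thesis by (simp add: E2_def)
  qed
  have mE3: "E3 i \<in> P.events" if "i \<in> I3" for i
  proof -
    obtain k j1 j2 j where i: "i = (k,j1,j2,j)" by (cases i)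
    have "Measurable.pred ?P (\<lambda>x. x j1 \<in> S k \<and> x j2 \<in> S' k \<and> x j \<in> B k)"
      using that H by (intro pred_intros_logic at meas) (auto simp: i I3_def)
    from predE[OF this] show ?thesis by (simp add: E3_def i)
  qed
  have b1: "P.prob (E1 s) \<le> exp (- (h * (m * p)))" if "s < t" for s
  proof -
    have "prob (\<Union>k\<in>F s. S k) = (\<Sum>k\<in>F s. prob (S k))"
      using FT[OF that] by (intro finite_measure_finite_Union)
        (auto simp: F_def intro: disjoint_family_on_mono[OF _ disj(1)])
    also have "\<dots> = (\<Sum>k\<in>F s. p)" using FT[OF that] p by (intro sum.cong) auto
    also have "\<dots> = m * p" by (simp add: F_def)
    finally have "m * p \<le> prob (\<Union>k\<in>F s. S k)" by simp
    then show ?thesis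
      unfolding E1_def card(1)[symmetric] using J by (intro measure_PiM_avoid_le) (auto simp: F_def)
  qed
  \<comment> \<open>Which targets are occupied is decided by \<open>H1\<close> alone, so the factor
    for \<open>H2\<close> splits off. The partners of the at least \<open>t\<close> targets in
    \<open>K\<close> are disjoint and have total mass at least \<open>t * p\<close>.\<close>
  have b2: "P.prob (E2 K) \<le> P.prob {x \<in> space ?P. occ x = K} * exp (- (h * (t * p)))" if K: "K \<in> KK" for K
  proof -
    have fK: "finite K" using that finite_subset by (auto simp: KK_def)
    have "prob (\<Union>k\<in>K. S' k) = (\<Sum>k\<in>K. prob (S' k))"
      using K fK by (intro finite_measure_finite_Union)
        (auto simp: KK_def intro: disjoint_family_on_mono[OF _ disj(2)])
    also have "\<dots> = (\<Sum>k\<in>K. p)" using K p by (intro sum.cong) (auto simp: KK_def)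
    also have "\<dots> = card K * p" by simp
    also have "\<dots> \<ge> t * p" using K p0 by (auto simp: KK_def intro: mult_right_mono)
    finally have *: "t * p \<le> prob (\<Union>k\<in>K. S' k)" .
    have "P.prob (E2 K) = P.prob {x \<in> space ?P. occ (restrict x H1) = K \<and> (\<forall>j\<in>H2. restrict x H2 j \<notin> (\<Union>k\<in>K. S' k))}"
      by (auto simp: E2_def occ_def intro!: arg_cong[where f = "P.prob"])
    also have "\<dots> = P.prob {x \<in> space ?P. occ (restrict x H1) = K} * P.prob {x \<in> space ?P. \<forall>j\<in>H2. restrict x H2 j \<notin> (\<Union>k\<in>K. S' k)}"
    proof (rule measure_PiM_indep_blocks[OF J])
      have "(\<lambda>x. occ x = K) = (\<lambda>x. \<forall>k\<in>{..<?T}. (\<exists>j\<in>H1. x j \<in> S k) \<longleftrightarrow> k \<in> K)"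
        using K by (auto simp: occ_def KK_def fun_eq_iff)
      then show "Measurable.pred (PiM H1 (\<lambda>_. M)) (\<lambda>x. occ x = K)"
        using fin by (simp only:) (intro pred_intros_finite pred_intros_logic at meas measurable_const, auto)
      show "Measurable.pred (PiM H2 (\<lambda>_. M)) (\<lambda>x. \<forall>j\<in>H2. x j \<notin> (\<Union>k\<in>K. S' k))"
        using fin fK by (simp only: UN_iff bex_simps) (intro pred_intros_finite pred_intros_logic at meas)
    qed
    also have "{x \<in> space ?P. occ (restrict x H1) = K} = {x \<in> space ?P. occ x = K}"
      by (auto simp: occ_def)
    also have "{x \<in> space ?P. \<forall>j\<in>H2. restrict x H2 j \<notin> (\<Union>k\<in>K. S' k)} = {x \<in> space ?P. \<forall>j\<in>H2. x j \<notin> (\<Union>k\<in>K. S' k)}"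
      by auto
    also have "P.prob {x \<in> space ?P. occ x = K} * P.prob {x \<in> space ?P. \<forall>j\<in>H2. x j \<notin> (\<Union>k\<in>K. S' k)}
       \<le> P.prob {x \<in> space ?P. occ x = K} * exp (- (h * (t * p)))"
      using J fK * unfolding card(2)[symmetric]
      by (intro mult_left_mono measure_PiM_avoid_le) auto
    finally show ?thesis .
  qed
  have b3: "P.prob (E3 i) \<le> p * p * b" if "i \<in> I3" for i
  proof -
    obtain k j1 j2 j where i: "i = (k,j1,j2,j)" by (cases i)
    then have ks: "k < ?T" "j1 \<in> H1" "j2 \<in> H2" "j \<in> J" using that by (auto simp: I3_def)
    show ?thesis
    \<comment> \<open>A spoiling point cannot be one of the two hitting points, because the targets
      avoid \<open>B k\<close>. Otherwise three distinct coordinates are prescribed and the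
      probabilities multiply.\<close>
    proof (cases "j = j1 \<or> j = j2")
      case True
      then have "E3 i = {}" using SB ks by (auto simp: E3_def i)
      then show ?thesis using p0 by simp
    next
      case False
      let ?X = "\<lambda>l. if l = j1 then S k else if l = j2 then S' k else B k"
      have ne: "j1 \<noteq> j2" using ks J by auto
      have E3_eq: "E3 i = {x \<in> space ?P. \<forall>l\<in>{j1,j2,j}. x l \<in> ?X l}"
        using False ne by (auto simp: E3_def i)
      have "P.prob (E3 i) = (\<Prod>l\<in>{j1,j2,j}. prob (?X l))"
        unfolding E3_eq using J ks by (intro measure_PiM_Collect) auto
      also have "\<dots> = p * p * prob (B k)" using False ne ks p by auto
      also have "\<dots> \<le> p * p * b" using b[OF ks(1)] p0 by (intro mult_left_mono) auto
      finally show ?thesis .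
    qed
  qed
  have "P.prob (\<Union>s<t. E1 s) \<le> (\<Sum>s<t. P.prob (E1 s))"
    using mE1 by (intro P.finite_measure_subadditive_finite) auto
  also have "\<dots> \<le> (\<Sum>s<t. exp (- (h * (m * p))))" using b1 by (intro sum_mono) auto
  finally have c1: "P.prob (\<Union>s<t. E1 s) \<le> t * exp (- (h * (m * p)))" by simp
  have mocc: "{x \<in> space ?P. occ x = K} \<in> P.events" if "K \<in> KK" for K
    using predE[OF pocc[OF that]] .
  have "P.prob (\<Union>K\<in>KK. E2 K) \<le> (\<Sum>K\<in>KK. P.prob (E2 K))"
    using mE2 finKK by (intro P.finite_measure_subadditive_finite) auto
  also have "\<dots> \<le> (\<Sum>K\<in>KK. P.prob {x \<in> space ?P. occ x = K} * exp (- (h * (t * p))))"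
    using b2 by (intro sum_mono) auto
  also have "\<dots> = (\<Sum>K\<in>KK. P.prob {x \<in> space ?P. occ x = K}) * exp (- (h * (t * p)))"
    by (simp add: sum_distrib_right)
  \<comment> \<open>The events \<open>occ x = K\<close> are disjoint for different \<open>K\<close>,
    so their probabilities sum to at most 1 and the number of possible sets \<open>K\<close> does
    not enter the bound.\<close>
  also have "(\<Sum>K\<in>KK. P.prob {x \<in> space ?P. occ x = K}) = P.prob (\<Union>K\<in>KK. {x \<in> space ?P. occ x = K})"
    using finKK mocc by (intro P.finite_measure_finite_Union[symmetric]) (auto simp: disjoint_family_on_def)
  also have "\<dots> * exp (- (h * (t * p))) \<le> 1 * exp (- (h * (t * p)))"
    by (intro mult_right_mono P.prob_le_1) auto
  finally have c2: "P.prob (\<Union>K\<in>KK. E2 K) \<le> exp (- (h * (t * p)))" by simp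
  have "P.prob (\<Union>i\<in>I3. E3 i) \<le> (\<Sum>i\<in>I3. P.prob (E3 i))"
    using mE3 finI3 by (intro P.finite_measure_subadditive_finite) auto
  also have "\<dots> \<le> (\<Sum>i\<in>I3. p * p * b)" using b3 by (intro sum_mono) auto
  also have "\<dots> = (t*m) * (h*p)^2 * (card J * b)"
    using card by (simp add: I3_def card_cartesian_product power2_eq_square algebra_simps)
  finally have c3: "P.prob (\<Union>i\<in>I3. E3 i) \<le> (t*m) * (h*p)^2 * (card J * b)" .
  have m1: "(\<Union>s<t. E1 s) \<in> P.events" using mE1 by auto
  have m2: "(\<Union>K\<in>KK. E2 K) \<in> P.events" using mE2 finKK by auto
  have m3: "(\<Union>i\<in>I3. E3 i) \<in> P.events" using mE3 finI3 by auto
  have "P.prob {x \<in> space ?P. \<not> (\<exists>k<?T. \<exists>j1\<in>H1. \<exists>j2\<in>H2. x j1 \<in> S k \<and> x j2 \<in> S' k \<and> (\<forall>j\<in>J. x j \<notin> B k))}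
    \<le> P.prob (((\<Union>s<t. E1 s) \<union> (\<Union>K\<in>KK. E2 K)) \<union> (\<Union>i\<in>I3. E3 i))"
    using sub m1 m2 m3 by (intro P.finite_measure_mono) auto
  also have "\<dots> \<le> P.prob (\<Union>s<t. E1 s) + P.prob (\<Union>K\<in>KK. E2 K) + P.prob (\<Union>i\<in>I3. E3 i)"
    using measure_Un_le[OF sets.Un[OF m1 m2] m3] measure_Un_le[OF m1 m2] by linarith
  finally show ?thesis using c1 c2 c3 by simp
qed

subsection \<open>Covering a unit disk by two nearby ones\<close>

text \<open>One point in each of the opposite slabs of slope \<open>y\<close> around \<open>x\<close> leaves uncovered only two pieces
  of the unit disk around \<open>x\<close>, near the directions orthogonal to the slabs, of width \<open>O(r)\<close> and
  height \<open>O(r\<^sup>2)\<close>; \<open>caps\<close> contains both.\<close>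

definition slab :: "real \<Rightarrow> real set \<Rightarrow> real \<times> real \<Rightarrow> real \<Rightarrow> (real \<times> real) set" where
  "slab r I x y = {z. fst z - fst x \<in> I \<and> \<bar>snd z - snd x - y * (fst z - fst x)\<bar> \<le> r\<^sup>2}"

definition caps :: "real \<Rightarrow> real \<times> real \<Rightarrow> real \<Rightarrow> (real \<times> real) set" where
  "caps r x y = {z. (\<bar>fst z - fst x + y\<bar> \<le> 5 * r \<or> \<bar>fst z - fst x - y\<bar> \<le> 5 * r) \<and>
     1 - 4 * r\<^sup>2 \<le> (fst z - fst x)\<^sup>2 + (snd z - snd x)\<^sup>2 \<and> (fst z - fst x)\<^sup>2 + (snd z - snd x)\<^sup>2 \<le> 1}"

lemma dist_prod_real_less_1_iff:
  "dist (z :: real \<times> real) x < 1 \<longleftrightarrow> (fst z - fst x)\<^sup>2 + (snd z - snd x)\<^sup>2 < 1"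
  by (simp add: dist_prod_def dist_real_def)

text \<open>Here \<open>(u, v)\<close> is the offset of a slab point from the centre. Both
  \<open>y * \<bar>u\<bar>\<close> and \<open>r\<^sup>2\<close> are at most \<open>r / 100\<close>,
  because \<open>y\<close> and \<open>r\<close> are at most \<open>1/100\<close>.\<close>

lemma slab_offset_bounds:
  fixes r Y y u v :: real
  assumes r: "0 < r" "r \<le> Y" "Y \<le> 1/100" and y: "0 \<le> y" "y \<le> Y"
    and u: "\<bar>u\<bar> \<le> r" and v: "\<bar>v - y * u\<bar> \<le> r\<^sup>2"
  shows "\<bar>v\<bar> \<le> r / 50" "u\<^sup>2 + v\<^sup>2 \<le> 2 * r\<^sup>2"
proof -
  have "\<bar>y * u\<bar> \<le> 1/100 * r"
    unfolding abs_mult using assms by (intro mult_mono) auto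
  moreover have "r\<^sup>2 \<le> 1/100 * r"
    unfolding power2_eq_square using assms by (intro mult_right_mono) auto
  ultimately show v': "\<bar>v\<bar> \<le> r / 50" using v by linarith
  have "u\<^sup>2 \<le> r\<^sup>2" "v\<^sup>2 \<le> r\<^sup>2"
    using u v' r by (auto simp: abs_le_square_iff[symmetric])
  then show "u\<^sup>2 + v\<^sup>2 \<le> 2 * r\<^sup>2" by simp
qed

text \<open>Expand the squared distance between the offsets \<open>(p, q)\<close> and
  \<open>(u, v)\<close> and replace \<open>v\<close> by \<open>y * u\<close> in the inner product.
  The term \<open>4 * r\<^sup>2\<close> collects
  \<open>u\<^sup>2 + v\<^sup>2 \<le> 2 * r\<^sup>2\<close> and the replacement error, which is at
  most \<open>2 * r\<^sup>2\<close>.\<close>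

lemma far_from_slab_point:
  fixes r Y y u v p q :: real
  assumes r: "0 < r" "r \<le> Y" "Y \<le> 1/100" and y: "0 \<le> y" "y \<le> Y"
    and u: "\<bar>u\<bar> \<le> r" and v: "\<bar>v - y * u\<bar> \<le> r\<^sup>2"
    and z: "p\<^sup>2 + q\<^sup>2 \<le> 1" and far: "1 \<le> (p - u)\<^sup>2 + (q - v)\<^sup>2"
  shows "1 - (p\<^sup>2 + q\<^sup>2) \<le> 4 * r\<^sup>2 - 2 * u * (p + q * y)"
proof -
  have "q\<^sup>2 \<le> 1" using z zero_le_power2[of p] by linarith
  then have "\<bar>q\<bar> \<le> 1" by (simp add: abs_square_le_1)
  then have "\<bar>q * (v - y * u)\<bar> \<le> 1 * r\<^sup>2"
    unfolding abs_mult using v by (intro mult_mono) auto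
  moreover have "(p - u)\<^sup>2 + (q - v)\<^sup>2 = p\<^sup>2 + q\<^sup>2 + (u\<^sup>2 + v\<^sup>2) - 2 * u * (p + q * y) - 2 * (q * (v - y * u))"
    by (simp add: power2_eq_square algebra_simps)
  ultimately show ?thesis
    using far slab_offset_bounds(2)[OF r y u v] by linarith
qed

text \<open>Let \<theta> be the inner product of the offset of \<open>z\<close> with the slab
  direction \<open>(1, y)\<close>. The bounds from \<open>a\<close> and \<open>b\<close> contain
  \<theta> with opposite signs: one of them gives the radial condition, and together, as the
  horizontal offsets are at least \<open>r / 2\<close> in size, they force \<bar>\<theta>\<bar>
  \<le> 4 * r. Then \<open>p\<close> is of order \<open>Y\<close>, so \<bar>q\<bar> is within 30 *
  \<open>Y\<^sup>2\<close> of 1, and replacing \<open>q * y\<close> by \<open>y\<close> or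
  \<open>- y\<close> costs at most \<open>30 * Y ^ 3 \<le> r\<close>. The sign of \<open>q\<close>
  decides which of the two caps contains \<open>z\<close>.\<close>

lemma in_caps_if_uncovered:
  fixes r Y y :: real
  assumes r: "0 < r" "r \<le> Y" "Y \<le> 1/100" "30 * Y ^ 3 \<le> r" and y: "0 \<le> y" "y \<le> Y"
    and a: "a \<in> slab r {r/2..r} x y" and b: "b \<in> slab r {-r..-r/2} x y"
    and z: "dist z x < 1" "\<not> dist z a < 1" "\<not> dist z b < 1"
  shows "z \<in> caps r x y"
proof -
  define p q where "p = fst z - fst x" and "q = snd z - snd x"
  define u v where "u = fst a - fst x" and "v = snd a - snd x"
  define u' v' where "u' = fst b - fst x" and "v' = snd b - snd x"
  define \<theta> where "\<theta> = p + q * y"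
  have u: "r/2 \<le> u" "u \<le> r" "\<bar>v - y * u\<bar> \<le> r\<^sup>2" using a by (auto simp: slab_def u_def v_def)
  have u': "-r \<le> u'" "u' \<le> -r/2" "\<bar>v' - y * u'\<bar> \<le> r\<^sup>2" using b by (auto simp: slab_def u'_def v'_def)
  have z1: "p\<^sup>2 + q\<^sup>2 < 1" using z(1) by (simp add: dist_prod_real_less_1_iff p_def q_def)
  have za: "1 \<le> (p - u)\<^sup>2 + (q - v)\<^sup>2" using z(2) by (simp add: dist_prod_real_less_1_iff p_def q_def u_def v_def)
  have zb: "1 \<le> (p - u')\<^sup>2 + (q - v')\<^sup>2" using z(3) by (simp add: dist_prod_real_less_1_iff p_def q_def u'_def v'_def)
  have A: "1 - (p\<^sup>2 + q\<^sup>2) \<le> 4 * r\<^sup>2 - 2 * u * \<theta>"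
    unfolding \<theta>_def using u z1 za by (intro far_from_slab_point[OF r(1-3) y, of u v]) auto
  have B: "1 - (p\<^sup>2 + q\<^sup>2) \<le> 4 * r\<^sup>2 - 2 * u' * \<theta>"
    unfolding \<theta>_def using u' z1 zb r by (intro far_from_slab_point[OF r(1-3) y, of u' v']) auto
  have radial: "1 - (p\<^sup>2 + q\<^sup>2) \<le> 4 * r\<^sup>2"
  proof (cases "\<theta> \<ge> 0")
    case True
    then have "0 \<le> u * \<theta>" using u r by auto
    then show ?thesis using A by simp
  next
    case False
    then have "0 \<le> u' * \<theta>" using u' r by (auto simp: mult_nonpos_nonpos)
    then show ?thesis using B by simp
  qed
  have th1: "\<theta> \<le> 4 * r"
  proof (rule ccontr)
    assume "\<not> ?thesis"
    then have "(r/2) * (4 * r) \<le> u * \<theta>" using u r by (intro mult_mono) auto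
    then show False using A z1 by (simp add: power2_eq_square)
  qed
  have th2: "- (4 * r) \<le> \<theta>"
  proof (rule ccontr)
    assume "\<not> ?thesis"
    then have "(r/2) * (4 * r) \<le> (-u') * (-\<theta>)" using u' r by (intro mult_mono) auto
    then show False using B z1 by (simp add: power2_eq_square)
  qed
  have "q\<^sup>2 \<le> 1" using z1 zero_le_power2[of p] by linarith
  then have q1: "\<bar>q\<bar> \<le> 1" by (simp add: abs_square_le_1)
  then have "\<bar>q * y\<bar> \<le> 1 * Y" unfolding abs_mult using y by (intro mult_mono) auto
  then have "\<bar>p\<bar> \<le> 5 * Y" using th1 th2 r unfolding \<theta>_def by linarith
  then have "\<bar>p\<bar>\<^sup>2 \<le> (5 * Y)\<^sup>2" by (intro power_mono) auto
  then have p2: "p\<^sup>2 \<le> 25 * Y\<^sup>2" by (simp add: power_mult_distrib)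
  have "r\<^sup>2 \<le> Y\<^sup>2" using r by (intro power_mono) auto
  \<comment> \<open>The constant leaves room for \<open>25 * Y\<^sup>2\<close> from
    \<open>p\<^sup>2\<close> and \<open>4 * Y\<^sup>2\<close> from the radial bound.\<close>
  then have "1 - q\<^sup>2 \<le> 30 * Y\<^sup>2" using p2 radial zero_le_power2[of Y] by linarith
  moreover have "\<bar>q\<bar>\<^sup>2 \<le> \<bar>q\<bar>" using power_decreasing[of 1 2 "\<bar>q\<bar>"] q1 by simp
  ultimately have "1 - \<bar>q\<bar> \<le> 30 * Y\<^sup>2" by simp
  then have "y * (1 - \<bar>q\<bar>) \<le> Y * (30 * Y\<^sup>2)" using y q1 by (intro mult_mono) auto
  then have yq: "y * (1 - \<bar>q\<bar>) \<le> r" using r(4) by (simp add: power2_eq_square power3_eq_cube)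
  have yq0: "0 \<le> y * (1 - \<bar>q\<bar>)" using y q1 by simp
  have "\<bar>p + y\<bar> \<le> 5 * r \<or> \<bar>p - y\<bar> \<le> 5 * r"
  proof (cases "q \<ge> 0")
    case True
    then have "p + y = \<theta> + y * (1 - \<bar>q\<bar>)" by (simp add: \<theta>_def algebra_simps)
    then show ?thesis using yq yq0 th1 th2 by linarith
  next
    case False
    then have "p - y = \<theta> - y * (1 - \<bar>q\<bar>)" by (simp add: \<theta>_def algebra_simps)
    then show ?thesis using yq yq0 th1 th2 by linarith
  qed
  then show ?thesis using radial z1 unfolding caps_def p_def q_def by auto
qed

text \<open>At horizontal distance at least \<open>r / 2\<close> from the centre the two middle
  lines are more than \<open>2 * r\<^sup>2\<close> apart, which is the sum of the half-heights. This
  is why slabs do not start at the centre itself.\<close>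

lemma disjoint_slabs:
  assumes "0 < r" "I = {r/2..r} \<or> I = {-r..-r/2}" "4 * r < \<bar>y - y'\<bar>"
  shows "slab r I x y \<inter> slab r I x y' = {}"
proof (rule ccontr)
  assume "\<not> ?thesis"
  then obtain z where z: "z \<in> slab r I x y" "z \<in> slab r I x y'" by auto
  define u v where "u = fst z - fst x" and "v = snd z - snd x"
  have u: "r / 2 \<le> \<bar>u\<bar>" using z(1) assms by (auto simp: slab_def u_def)
  have "\<bar>v - y * u\<bar> \<le> r\<^sup>2" "\<bar>v - y' * u\<bar> \<le> r\<^sup>2" using z by (auto simp: slab_def u_def v_def)
  then have "\<bar>(y - y') * u\<bar> \<le> 2 * r\<^sup>2" by (simp add: left_diff_distrib)
  moreover have "4 * r * (r/2) < \<bar>y - y'\<bar> * \<bar>u\<bar>" using u assms by (intro mult_less_le_imp_less) auto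
  ultimately show False by (simp add: abs_mult power2_eq_square)
qed

text \<open>Slab points are within distance \<open>sqrt 2 * r\<close> of the centre, while caps lie
  next to the unit circle.\<close>

lemma slab_cap_disjoint:
  assumes r: "0 < r" "r \<le> Y" "Y \<le> 1/100" and y: "0 \<le> y" "y \<le> Y" and I: "I \<subseteq> {-r..r}"
  shows "slab r I x y \<inter> caps r x y' = {}"
proof (rule ccontr)
  assume "\<not> ?thesis"
  then obtain z where z: "z \<in> slab r I x y" "z \<in> caps r x y'" by auto
  have "\<bar>fst z - fst x\<bar> \<le> r" using z(1) I unfolding slab_def by fastforce
  then have "(fst z - fst x)\<^sup>2 + (snd z - snd x)\<^sup>2 \<le> 2 * r\<^sup>2"
    using z(1) by (intro slab_offset_bounds[OF r y]) (auto simp: slab_def)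
  moreover have "r\<^sup>2 \<le> (1/100)\<^sup>2" using r by (intro power_mono) auto
  ultimately show False using z(2) by (auto simp: caps_def power2_eq_square)
qed

lemma rule2_excluded_if_slabs_hit:
  fixes r Y y :: real
  assumes r: "0 < r" "r \<le> Y" "Y \<le> 1/100" "30 * Y ^ 3 \<le> r" and y: "0 \<le> y" "y \<le> Y"
    and i: "i < i2" "i2 < i1" "1 \<le> i" "i1 \<le> n"
    and a: "p i2 \<in> slab r {r/2..r} (p i) y" and b: "p i1 \<in> slab r {-r..-r/2} (p i) y"
    and empty: "\<forall>j\<in>{1..n} - {i}. p j \<notin> caps r (p i) y"
  shows "rule2_excluded n p i"
proof -
  \<comment> \<open>Distance below 1/2, rather than 1, makes \<open>i1\<close> and \<open>i2\<close>
    adjacent to each other by the triangle inequality.\<close>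
  have close: "dist (p j) (p i) < 1/2" if "j = i1 \<or> j = i2" for j
  proof -
    have *: "\<bar>fst (p j) - fst (p i)\<bar> \<le> r" "\<bar>snd (p j) - snd (p i) - y * (fst (p j) - fst (p i))\<bar> \<le> r\<^sup>2"
      using that a b r by (auto simp: slab_def)
    have "(fst (p j) - fst (p i))\<^sup>2 + (snd (p j) - snd (p i))\<^sup>2 \<le> 2 * r\<^sup>2"
      by (rule slab_offset_bounds(2)[OF r(1-3) y *])
    also have "\<dots> \<le> 2 * (1/100)\<^sup>2" using r by (intro mult_left_mono power_mono) auto
    also have "\<dots> < (1/2)\<^sup>2" by (simp add: power2_eq_square)
    finally show ?thesis unfolding dist_prod_def dist_real_def
      by (intro real_less_lsqrt) auto
  qed
  have "dist (p i1) (p i2) < 1"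
    using dist_triangle_half_l[of "p i1" "p i" 1 "p i2"] close by auto
  then have adj: "udg_adj p i1 i2" using i by (auto simp: udg_adj_def)
  have nb: "i1 \<in> closed_nbhd n p i" "i2 \<in> closed_nbhd n p i"
    using close[of i1] close[of i2] i by (auto simp: closed_nbhd_def udg_adj_def dist_commute)
  have "closed_nbhd n p i \<subseteq> closed_nbhd n p i1 \<union> closed_nbhd n p i2"
  proof
    fix j assume j: "j \<in> closed_nbhd n p i"
    show "j \<in> closed_nbhd n p i1 \<union> closed_nbhd n p i2"
    proof (cases "j = i \<or> j = i1 \<or> j = i2")
      case True
      then show ?thesis using close[of i1] i by (auto simp: closed_nbhd_def udg_adj_def)
    next
      case False
      then have j': "j \<in> {1..n} - {i}" "dist (p j) (p i) < 1"
        using j by (auto simp: closed_nbhd_def udg_adj_def dist_commute)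
      then have "dist (p j) (p i2) < 1 \<or> dist (p j) (p i1) < 1"
        using in_caps_if_uncovered[OF r y a b] empty by blast
      then show ?thesis using j' False by (auto simp: closed_nbhd_def udg_adj_def dist_commute)
    qed
  qed
  then show ?thesis unfolding rule2_excluded_def using nb adj i by blast
qed

section \<open>Measurability and area of slabs and caps\<close>

lemma slab_measurable [measurable]:
  assumes [measurable]: "I \<in> sets borel"
  shows "slab r I x y \<in> sets borel"
proof -
  have [measurable]: "fst \<in> borel_measurable (borel :: (real \<times> real) measure)"
    "snd \<in> borel_measurable (borel :: (real \<times> real) measure)"
    by (intro borel_measurable_continuous_onI continuous_intros)+
  have "{z \<in> space borel. fst z - fst x \<in> I \<and> \<bar>snd z - snd x - y * (fst z - fst x)\<bar> \<le> r\<^sup>2} \<in> sets borel"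
    by measurable
  then show ?thesis by (simp add: slab_def)
qed

lemma caps_measurable [measurable]: "caps r x y \<in> sets borel"
proof -
  have [measurable]: "fst \<in> borel_measurable (borel :: (real \<times> real) measure)"
    "snd \<in> borel_measurable (borel :: (real \<times> real) measure)"
    by (intro borel_measurable_continuous_onI continuous_intros)+
  have "{z \<in> space borel. (\<bar>fst z - fst x + y\<bar> \<le> 5 * r \<or> \<bar>fst z - fst x - y\<bar> \<le> 5 * r) \<and>
     1 - 4 * r\<^sup>2 \<le> (fst z - fst x)\<^sup>2 + (snd z - snd x)\<^sup>2 \<and>
     (fst z - fst x)\<^sup>2 + (snd z - snd x)\<^sup>2 \<le> 1} \<in> sets borel"
    by measurable
  then show ?thesis by (simp add: caps_def)
qed

lemma sets_lborel_pair: "sets (lborel \<Otimes>\<^sub>M lborel :: (real \<times> real) measure) = sets borel"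
  by (metis lborel_prod sets_lborel)

text \<open>A slab is a sheared rectangle: every nonempty vertical section is an interval of length
  \<open>2 * r\<^sup>2\<close>. Hence slabs of all slopes have the same area.\<close>

lemma emeasure_slab:
  assumes "0 \<le> r" "c \<le> d"
  shows "emeasure lborel (slab r {c..d} x y) = ennreal (2 * r\<^sup>2 * (d - c))"
proof -
  have "emeasure lborel (slab r {c..d} x y) = (\<integral>\<^sup>+ u. emeasure lborel (Pair u -` slab r {c..d} x y) \<partial>lborel)"
    unfolding lborel_prod[symmetric]
    by (rule lborel.emeasure_pair_measure_alt) (simp only: sets_lborel_pair, measurable)
  also have "\<dots> = (\<integral>\<^sup>+ u. ennreal (2 * r\<^sup>2) * indicator {fst x + c..fst x + d} u \<partial>lborel)"
  proof (rule nn_integral_cong)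
    fix u :: real
    have "Pair u -` slab r {c..d} x y = (if u \<in> {fst x + c..fst x + d}
       then {snd x + y * (u - fst x) - r\<^sup>2 .. snd x + y * (u - fst x) + r\<^sup>2} else {})"
      by (auto simp: slab_def abs_le_iff)
    then show "emeasure lborel (Pair u -` slab r {c..d} x y) = ennreal (2 * r\<^sup>2) * indicator {fst x + c..fst x + d} u"
      by auto
  qed
  also have "\<dots> = ennreal (2 * r\<^sup>2) * ennreal (d - c)"
    using assms by (subst nn_integral_cmult_indicator) auto
  finally show ?thesis using assms by (simp add: ennreal_mult)
qed

text \<open>The first coordinates fill two intervals of length \<open>10 * r\<close>, and over each
  of them the thin annulus has an upper and a lower section, each of length at most
  \<open>4 * r\<^sup>2\<close>.\<close>

lemma emeasure_caps_le:
  assumes r: "0 < r" "r \<le> 1/100" and y: "0 \<le> y" "y \<le> 1/100"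
  shows "emeasure lborel (caps r x y) \<le> ennreal (160 * r ^ 3)"
proof -
  define C where "C = {fst x - y - 5*r .. fst x - y + 5*r} \<union> {fst x + y - 5*r .. fst x + y + 5*r}"
  have "emeasure lborel (caps r x y) = (\<integral>\<^sup>+ u. emeasure lborel (Pair u -` caps r x y) \<partial>lborel)"
    unfolding lborel_prod[symmetric]
    by (rule lborel.emeasure_pair_measure_alt) (simp only: sets_lborel_pair, measurable)
  also have "\<dots> \<le> (\<integral>\<^sup>+ u. ennreal (8 * r\<^sup>2) * indicator C u \<partial>lborel)"
  proof (rule nn_integral_mono)
    fix u :: real
    show "emeasure lborel (Pair u -` caps r x y) \<le> ennreal (8 * r\<^sup>2) * indicator C u"
    proof (cases "u \<in> C")
      case False
      then have "Pair u -` caps r x y = {}" by (auto simp: caps_def C_def)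
      then show ?thesis by simp
    next
      case True
      \<comment> \<open>The vertical section of the annulus consists of the heights whose square
        lies between \<open>A\<close> and \<open>A + 4 * r\<^sup>2\<close>. Near the centre column
        \<open>A\<close> is bounded away from 0, so taking square roots does not enlarge the
        gap.\<close>
      define A where "A = 1 - 4 * r\<^sup>2 - (u - fst x)\<^sup>2"
      have "\<bar>u - fst x\<bar> \<le> 1/10" unfolding abs_le_iff using True r y by (auto simp: C_def)
      then have "\<bar>u - fst x\<bar>\<^sup>2 \<le> (1/10)\<^sup>2" by (intro power_mono) auto
      moreover have "r\<^sup>2 \<le> (1/100)\<^sup>2" using r by (intro power_mono) auto
      ultimately have A: "1/4 \<le> A" by (simp add: A_def power2_eq_square)
      then have sA: "1/2 \<le> sqrt A" by (intro real_le_rsqrt) (auto simp: power2_eq_square)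
      have up: "sqrt (A + 4 * r\<^sup>2) \<le> sqrt A + 4 * r\<^sup>2"
      proof (rule real_le_lsqrt)
        have "1/2 * (4 * r\<^sup>2) \<le> sqrt A * (4 * r\<^sup>2)" using sA by (intro mult_right_mono) auto
        moreover have "(sqrt A)\<^sup>2 = A" using A by simp
        ultimately show "A + 4 * r\<^sup>2 \<le> (sqrt A + 4 * r\<^sup>2)\<^sup>2"
          using zero_le_power2[of "4 * r\<^sup>2"] unfolding power2_sum by linarith
      qed (use sA A in \<open>auto intro!: add_nonneg_nonneg\<close>)
      have "Pair u -` caps r x y \<subseteq> {snd x + sqrt A .. snd x + (sqrt A + 4 * r\<^sup>2)} \<union> {snd x - (sqrt A + 4 * r\<^sup>2) .. snd x - sqrt A}"
      proof
        fix v assume "v \<in> Pair u -` caps r x y"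
        then have "A \<le> (v - snd x)\<^sup>2" "(v - snd x)\<^sup>2 \<le> A + 4 * r\<^sup>2" by (auto simp: caps_def A_def)
        then have "sqrt A \<le> sqrt ((v - snd x)\<^sup>2)" "sqrt ((v - snd x)\<^sup>2) \<le> sqrt (A + 4 * r\<^sup>2)"
          by (simp_all only: real_sqrt_le_iff)
        then have "sqrt A \<le> \<bar>v - snd x\<bar>" "\<bar>v - snd x\<bar> \<le> sqrt A + 4 * r\<^sup>2" using up by auto
        then show "v \<in> {snd x + sqrt A .. snd x + (sqrt A + 4 * r\<^sup>2)} \<union> {snd x - (sqrt A + 4 * r\<^sup>2) .. snd x - sqrt A}"
          by auto
      qed
      then have "emeasure lborel (Pair u -` caps r x y) \<le> emeasure lborel ({snd x + sqrt A .. snd x + (sqrt A + 4 * r\<^sup>2)} \<union> {snd x - (sqrt A + 4 * r\<^sup>2) .. snd x - sqrt A})"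
        by (intro emeasure_mono) auto
      also have "\<dots> \<le> emeasure lborel {snd x + sqrt A .. snd x + (sqrt A + 4 * r\<^sup>2)} + emeasure lborel {snd x - (sqrt A + 4 * r\<^sup>2) .. snd x - sqrt A}"
        by (intro emeasure_subadditive) auto
      also have "\<dots> = ennreal (8 * r\<^sup>2)"
        by (simp add: ennreal_plus[symmetric] del: ennreal_plus)
      finally show ?thesis using True by simp
    qed
  qed
  also have "\<dots> = ennreal (8 * r\<^sup>2) * emeasure lborel C"
    by (subst nn_integral_cmult_indicator) (auto simp: C_def)
  also have "\<dots> \<le> ennreal (8 * r\<^sup>2) * ennreal (20 * r)"
  proof (rule mult_left_mono)
    have "emeasure lborel C \<le> emeasure lborel {fst x - y - 5*r .. fst x - y + 5*r} + emeasure lborel {fst x + y - 5*r .. fst x + y + 5*r}"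
      unfolding C_def by (intro emeasure_subadditive) auto
    also have "\<dots> = ennreal (20 * r)"
      using r by (simp add: ennreal_plus[symmetric] del: ennreal_plus)
    finally show "emeasure lborel C \<le> ennreal (20 * r)" .
  qed simp
  also have "\<dots> = ennreal (160 * r ^ 3)"
    using r by (simp add: ennreal_mult[symmetric] power2_eq_square power3_eq_cube)
  finally show ?thesis .
qed

subsection \<open>Uniform points in a square\<close>

lemma Icc_prod_measurable [measurable]:
  "{a..b} \<times> {c..d} \<in> sets (borel :: (real \<times> real) measure)"
  by (intro borel_closed closed_Times closed_atLeastAtMost)

lemma square_measurable [measurable]: "square l \<in> sets borel"
  by (simp add: square_def)

lemma emeasure_lborel_Icc_prod:
  assumes "a \<le> b"
  shows "emeasure lborel ({a..b} \<times> {a..b} :: (real \<times> real) set) = ennreal ((b - a)\<^sup>2)"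
  using assms lborel.emeasure_pair_measure_Times[of "{a..b}" lborel "{a..b}"]
  by (simp add: lborel_prod ennreal_mult[symmetric] power2_eq_square)

lemma prob_space_uniform_square:
  "0 < l \<Longrightarrow> prob_space (uniform_measure lborel (square l))"
  by (intro prob_space_uniform_measure) (auto simp: square_def emeasure_lborel_Icc_prod)

lemma measure_uniform_square:
  assumes "0 < l" "A \<in> sets borel"
  shows "measure (uniform_measure lborel (square l)) A = measure lborel (square l \<inter> A) / l\<^sup>2"
  using assms measure_uniform_measure[of lborel "square l" A]
  by (simp add: square_def emeasure_lborel_Icc_prod measure_def)

lemma measure_uniform_square_le:
  assumes "0 < l" "A \<in> sets borel" "emeasure lborel A \<le> ennreal c" "0 \<le> c"
  shows "measure (uniform_measure lborel (square l)) A \<le> c / l\<^sup>2"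
proof -
  have "emeasure lborel (square l \<inter> A) \<le> ennreal c"
    using emeasure_mono[of "square l \<inter> A" A lborel] assms by (auto intro: order_trans)
  then have "measure lborel (square l \<inter> A) \<le> c"
    using assms(4) by (simp add: measure_def enn2real_leI)
  then show ?thesis
    using assms by (simp add: measure_uniform_square divide_right_mono)
qed

section \<open>Rule 2 as an event, and the survival probability of one vertex\<close>

lemma closed_nbhd_cong:
  assumes "\<And>j. j \<in> {1..n} \<Longrightarrow> p j = p' j" "i \<in> {1..n}"
  shows "closed_nbhd n p i = closed_nbhd n p' i"
  using assms by (auto simp: closed_nbhd_def udg_adj_def)

text \<open>With all quantifiers bounded by \<open>{1..n}\<close>, exclusion is a finite Boolean
  combination of adjacency relations, which yields its measurability.\<close>

lemma rule2_excluded_iff: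
  assumes "i \<in> {1..n}"
  shows "rule2_excluded n p i \<longleftrightarrow>
     (\<exists>i1\<in>{1..n}. \<exists>i2\<in>{1..n}. i1 \<in> closed_nbhd n p i \<and> i2 \<in> closed_nbhd n p i \<and> i1 > i2 \<and> i2 > i \<and>
        (\<forall>j\<in>{1..n}. j \<in> closed_nbhd n p i \<longrightarrow> j \<in> closed_nbhd n p i1 \<or> j \<in> closed_nbhd n p i2) \<and>
        udg_adj p i1 i2)"
proof -
  have "closed_nbhd n p i \<subseteq> {1..n}" using assms by (auto simp: closed_nbhd_def)
  then show ?thesis unfolding rule2_excluded_def by blast
qed

lemma rule2_excluded_cong:
  assumes "\<And>j. j \<in> {1..n} \<Longrightarrow> p j = p' j" "i \<in> {1..n}"
  shows "rule2_excluded n p i = rule2_excluded n p' i"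
proof -
  have "closed_nbhd n p j = closed_nbhd n p' j" if "j \<in> {1..n}" for j
    using assms that by (intro closed_nbhd_cong) auto
  moreover have "udg_adj p j k = udg_adj p' j k" if "j \<in> {1..n}" "k \<in> {1..n}" for j k
    using assms that by (auto simp: udg_adj_def)
  ultimately show ?thesis
    using assms(2) by (simp add: rule2_excluded_iff)
qed

text \<open>Points of the product space are \<open>undefined\<close> outside \<open>{1..n}\<close>,
  so the random positions have to be restricted to \<open>{1..n}\<close> without changing the
  count.\<close>

lemma num_excluded_cong:
  assumes "\<And>j. j \<in> {1..n} \<Longrightarrow> p j = p' j"
  shows "num_excluded n p = num_excluded n p'"
  unfolding num_excluded_def using rule2_excluded_cong[of n p p'] assms
  by (intro arg_cong[where f = card] Collect_cong conj_cong) auto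

lemma pred_rule2_excluded:
  assumes sets_N: "sets N = sets borel" and i: "i \<in> {1..n}"
  shows "Measurable.pred (PiM {1..n} (\<lambda>_. N)) (\<lambda>p. rule2_excluded n p i)"
proof -
  have [measurable]: "(\<lambda>p. p j) \<in> borel_measurable (PiM {1..n} (\<lambda>_. N))" if "j \<in> {1..n}" for j
    using measurable_component_singleton[OF that, of "\<lambda>_. N"] measurable_cong_sets[OF refl sets_N] by blast
  have adj [measurable]: "Measurable.pred (PiM {1..n} (\<lambda>_. N)) (\<lambda>p. udg_adj p j k)"
    if "j \<in> {1..n}" "k \<in> {1..n}" for j k
    unfolding udg_adj_def using that by measurable
  have nb: "Measurable.pred (PiM {1..n} (\<lambda>_. N)) (\<lambda>p. k \<in> closed_nbhd n p j)"
    if "j \<in> {1..n}" "k \<in> {1..n}" for j k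
  proof -
    have "(\<lambda>p. k \<in> closed_nbhd n p j) = (\<lambda>p. k = j \<or> udg_adj p j k)"
      using that by (auto simp: closed_nbhd_def)
    then show ?thesis using adj[OF that] by simp
  qed
  show ?thesis unfolding rule2_excluded_iff[OF i]
    by (intro pred_intros_finite pred_intros_logic nb adj i finite_atLeastAtMost measurable_const) auto
qed

text \<open>The bound of \<open>prob_no_clean_pair_le\<close> for \<open>t\<close> blocks of length
  \<open>t\<close>, with the area ratios of a slab and of the caps as probabilities and
  \<open>n\<close> as the number of points that may spoil a pair.\<close>

definition no_clean_pair_bound :: "nat \<Rightarrow> real \<Rightarrow> nat \<Rightarrow> real \<Rightarrow> nat \<Rightarrow> real" where
  "no_clean_pair_bound n l h r t =
     t * exp (- (h * (t * (r^3 / l\<^sup>2)))) + exp (- (h * (t * (r^3 / l\<^sup>2))))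
     + (t*t) * (h * (r^3 / l\<^sup>2))\<^sup>2 * (n * (160 * r^3 / l\<^sup>2))"

text \<open>Ensures that no slab is cut off by the boundary, so that each has probability exactly
  \<open>r ^ 3 / l\<^sup>2\<close>.\<close>

lemma slab_subset_square:
  assumes r: "0 < r" "r \<le> Y" "Y \<le> 1/100" and y: "0 \<le> y" "y \<le> Y" and I: "I \<subseteq> {-r..r}"
    and x: "x \<in> {2*r..l-2*r} \<times> {2*r..l-2*r}"
  shows "slab r I x y \<subseteq> square l"
proof
  fix z assume z: "z \<in> slab r I x y"
  have u: "\<bar>fst z - fst x\<bar> \<le> r" using z I unfolding slab_def by fastforce
  then have "\<bar>snd z - snd x\<bar> \<le> r / 50"
    using z by (intro slab_offset_bounds(1)[OF r y]) (auto simp: slab_def)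
  then have "\<bar>snd z - snd x\<bar> \<le> r" using r by linarith
  then show "z \<in> square l"
    using u x r by (cases z) (auto simp: square_def abs_le_iff)
qed

lemma prob_not_excluded_given_position_le:
  fixes r l :: real and n h t i :: nat
  defines "U \<equiv> uniform_measure lborel (square l)"
  defines "Y \<equiv> 5 * r * (t * t)"
  assumes r: "0 < r" "Y \<le> 1/100" "30 * Y ^ 3 \<le> r" and l: "0 < l" and t: "1 \<le> t" and h: "1 \<le> h"
    and i: "1 \<le> i" "i + 2 * h \<le> n"
    and x: "x \<in> {2*r..l-2*r} \<times> {2*r..l-2*r}"
  shows "(\<integral>\<^sup>+ p. indicator {p. \<not> rule2_excluded n (p(i := x)) i} p \<partial>PiM ({1..n} - {i}) (\<lambda>_. U))
    \<le> ennreal (no_clean_pair_bound n l h r t)"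
proof -
  interpret prob_space U unfolding U_def using l by (rule prob_space_uniform_square)
  define J where "J = {1..n} - {i}"
  \<comment> \<open>All indices in \<open>H1\<close> precede those in \<open>H2\<close>, and
    \<open>i + 2 * h \<le> n\<close> places both above \<open>i\<close>. This supplies the ID order
    that Rule 2 demands.\<close>
  define H1 where "H1 = {n - 2*h<..n-h}"
  define H2 where "H2 = {n - h<..n}"
  \<comment> \<open>Slopes spaced by \<open>5 * r\<close> exceed the separation \<open>4 * r\<close>
    needed for disjoint slabs, and all \<open>t * t\<close> of them stay below
    \<open>Y\<close>.\<close>
  define y :: "nat \<Rightarrow> real" where "y k = 5 * r * k" for k
  define S where "S k = slab r {r/2..r} x (y k)" for k
  define S' where "S' k = slab r {-r..-r/2} x (y k)" for k
  define B where "B k = caps r x (y k)" for k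
  have setsU [simp]: "sets U = sets borel" by (simp add: U_def)
  have [measurable]: "S k \<in> events" "S' k \<in> events" "B k \<in> events" for k
    by (simp_all add: S_def S'_def B_def)
  have rY: "r \<le> Y"
  proof -
    have "(1::real) \<le> t * t" using t by (metis mult_le_mono nat_mult_1 of_nat_1 of_nat_le_iff of_nat_mult)
    then have "r * 1 \<le> r * (5 * (t * t))" using r by (intro mult_left_mono) auto
    then show ?thesis by (simp add: Y_def)
  qed
  have y: "0 \<le> y k" "k < t * t \<Longrightarrow> y k \<le> Y" for k
  proof -
    show "0 \<le> y k" using r by (simp add: y_def)
    assume "k < t * t"
    then have "real k \<le> real (t * t)" by linarith
    then show "y k \<le> Y" using r unfolding y_def Y_def by (intro mult_left_mono) auto
  qed
  have sep: "4 * r < \<bar>y k - y k'\<bar>" if "k \<noteq> k'" for k k'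
  proof -
    have "1 \<le> \<bar>real k - real k'\<bar>" using that by linarith
    then have "5 * r * 1 \<le> 5 * r * \<bar>real k - real k'\<bar>" using r by (intro mult_left_mono) auto
    also have "\<dots> = \<bar>y k - y k'\<bar>"
      using r unfolding y_def right_diff_distrib[symmetric] abs_mult by simp
    finally show ?thesis using r by simp
  qed
  have prob_slab: "prob (slab r {c..d} x (y k)) = r^3 / l\<^sup>2"
    if k: "k < t * t" and cd: "{c..d} \<subseteq> {-r..r}" "d - c = r / 2" for k c d
  proof -
    have "square l \<inter> slab r {c..d} x (y k) = slab r {c..d} x (y k)"
      using slab_subset_square[OF r(1) rY r(2) y(1) y(2)[OF k] cd(1) x] by auto
    moreover have "measure lborel (slab r {c..d} x (y k)) = r ^ 3"
      using emeasure_slab[of r c d x "y k"] r cd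
      by (simp add: measure_def power2_eq_square power3_eq_cube)
    ultimately show ?thesis
      unfolding U_def using l by (simp add: measure_uniform_square)
  qed
  have "measure (PiM J (\<lambda>_. U)) {p \<in> space (PiM J (\<lambda>_. U)).
      \<not> (\<exists>k<t*t. \<exists>j1\<in>H1. \<exists>j2\<in>H2. p j1 \<in> S k \<and> p j2 \<in> S' k \<and> (\<forall>j\<in>J. p j \<notin> B k))}
    \<le> t * exp (- (h * (t * (r^3 / l\<^sup>2)))) + exp (- (h * (t * (r^3 / l\<^sup>2))))
      + (t*t) * (h * (r^3 / l\<^sup>2))\<^sup>2 * (card J * (160 * r^3 / l\<^sup>2))"
  proof (rule prob_no_clean_pair_le)
    show "finite J" "H1 \<subseteq> J" "H2 \<subseteq> J" "H1 \<inter> H2 = {}" "card H1 = h" "card H2 = h"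
      using i h by (auto simp: J_def H1_def H2_def)
    have "n \<in> J" using i h by (auto simp: J_def)
    then show "J \<noteq> {}" by auto
    show "disjoint_family_on S {..<t*t}" "disjoint_family_on S' {..<t*t}"
      unfolding disjoint_family_on_def S_def S'_def using r(1) sep
      by (intro ballI impI disjoint_slabs; simp)+
    show "S k \<inter> B k = {}" "S' k \<inter> B k = {}" if "k < t * t" for k
      unfolding S_def S'_def B_def using r
      by (intro slab_cap_disjoint[OF r(1) rY r(2) y(1) y(2)[OF that]]; auto)+
    show "prob (S k) = r^3 / l\<^sup>2" "prob (S' k) = r^3 / l\<^sup>2" if "k < t * t" for k
      unfolding S_def S'_def using that r by (auto intro!: prob_slab)
    show "prob (B k) \<le> 160 * r^3 / l\<^sup>2" if "k < t * t" for k
      unfolding B_def U_def using y(2)[OF that] y(1) r rY l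
      by (intro measure_uniform_square_le emeasure_caps_le) auto
    show "0 \<le> r^3 / l\<^sup>2" "0 \<le> 160 * r^3 / l\<^sup>2" using r by auto
  qed fact+
  also have "\<dots> \<le> no_clean_pair_bound n l h r t"
  proof -
    have "card J \<le> n" unfolding J_def by (metis card_Diff1_le card_atLeastAtMost diff_Suc_1)
    then show ?thesis unfolding no_clean_pair_bound_def of_nat_mult
      using r by (intro add_left_mono mult_left_mono mult_right_mono) auto
  qed
  finally have bound: "measure (PiM J (\<lambda>_. U)) {p \<in> space (PiM J (\<lambda>_. U)).
      \<not> (\<exists>k<t*t. \<exists>j1\<in>H1. \<exists>j2\<in>H2. p j1 \<in> S k \<and> p j2 \<in> S' k \<and> (\<forall>j\<in>J. p j \<notin> B k))}
    \<le> no_clean_pair_bound n l h r t" (is "measure _ ?F \<le> _") .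
  interpret P: product_prob_space "\<lambda>_. U" J
    by (intro product_prob_spaceI) (rule prob_space_axioms)
  have HJ: "j \<in> J" if "j \<in> H1 \<or> j \<in> H2" for j
    using that i by (auto simp: J_def H1_def H2_def)
  have "?F = {p \<in> space (PiM J (\<lambda>_. U)).
      \<not> (\<exists>k\<in>{..<t*t}. \<exists>j1\<in>H1. \<exists>j2\<in>H2. p j1 \<in> S k \<and> p j2 \<in> S' k \<and> (\<forall>j\<in>J. p j \<notin> B k))}"
    by auto
  also have "\<dots> \<in> P.events"
  proof -
    have [simp]: "finite H1" "finite H2" "finite J" by (auto simp: J_def H1_def H2_def)
    have "(\<lambda>p. p j) \<in> measurable (PiM J (\<lambda>_. U)) U" if "j \<in> J" for j
      using that by measurable
    then show ?thesis using HJ by measurable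
  qed
  finally have mF: "?F \<in> P.events" .
  have excl: "rule2_excluded n (p(i := x)) i" if p: "p \<in> space (PiM J (\<lambda>_. U))" "p \<notin> ?F" for p
  proof -
    obtain k j1 j2 where k: "k < t*t" "j1 \<in> H1" "j2 \<in> H2" "p j1 \<in> S k" "p j2 \<in> S' k" "\<forall>j\<in>J. p j \<notin> B k"
      using p by auto
    have "i < j1" "j1 < j2" "j2 \<le> n" using k i h by (auto simp: H1_def H2_def)
    then show ?thesis
      using k r i rY y
      by (intro rule2_excluded_if_slabs_hit[of r Y "y k" i j1 j2])
         (auto simp: S_def S'_def B_def J_def)
  qed
  have "(\<integral>\<^sup>+ p. indicator {p. \<not> rule2_excluded n (p(i := x)) i} p \<partial>PiM J (\<lambda>_. U))
    \<le> (\<integral>\<^sup>+ p. indicator ?F p \<partial>PiM J (\<lambda>_. U))"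
    using excl by (intro nn_integral_mono) (auto simp: indicator_def)
  also have "\<dots> = emeasure (PiM J (\<lambda>_. U)) ?F"
    using mF by (rule nn_integral_indicator)
  also have "\<dots> \<le> ennreal (no_clean_pair_bound n l h r t)"
    using bound by (simp add: P.emeasure_eq_measure ennreal_leI)
  finally show ?thesis by (simp add: J_def)
qed

lemma no_clean_pair_bound_nonneg: "0 \<le> r \<Longrightarrow> 0 \<le> no_clean_pair_bound n l h r t"
  by (simp add: no_clean_pair_bound_def)

lemma prob_near_edge_le:
  assumes "0 < r" "4 * r \<le> l" "0 < l"
  shows "measure (uniform_measure lborel (square l)) (- ({2*r..l-2*r} \<times> {2*r..l-2*r})) \<le> 8 * r / l"
proof -
  let ?U = "uniform_measure lborel (square l)"
  let ?Q = "{2*r..l-2*r} \<times> {2*r..l-2*r}"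
  interpret prob_space ?U using assms by (intro prob_space_uniform_square)
  have Q: "?Q \<in> sets borel" by (rule Icc_prod_measurable)
  have "square l \<inter> ?Q = ?Q" using assms by (auto simp: square_def)
  moreover have "measure lborel ?Q = (l - 4 * r)\<^sup>2"
    using assms by (simp add: measure_def emeasure_lborel_Icc_prod)
  ultimately have "prob ?Q = (l - 4 * r)\<^sup>2 / l\<^sup>2"
    using assms Q by (simp add: measure_uniform_square)
  moreover have "prob (- ?Q) = 1 - prob ?Q"
    using prob_compl[of ?Q] Q by (simp add: Compl_eq_Diff_UNIV)
  moreover have "1 - (l - 4 * r)\<^sup>2 / l\<^sup>2 \<le> 8 * r / l"
    using assms by (simp add: field_simps power2_eq_square)
  ultimately show ?thesis by simp
qed

text \<open>By Fubini, integrate over the other points first and over the position of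
  \<open>i\<close> last. Positions within \<open>2 * r\<close> of the boundary get the trivial bound
  1 and have total probability at most \<open>8 * r / l\<close>.\<close>

lemma prob_not_excluded_le:
  fixes r l :: real and n h t i :: nat
  defines "U \<equiv> uniform_measure lborel (square l)"
  defines "Y \<equiv> 5 * r * (t * t)"
  assumes r: "0 < r" "Y \<le> 1/100" "30 * Y ^ 3 \<le> r" "4 * r \<le> l" and l: "0 < l" and t: "1 \<le> t" and h: "1 \<le> h"
    and i: "1 \<le> i" "i + 2 * h \<le> n"
  shows "measure (PiM {1..n} (\<lambda>_. U)) {p \<in> space (PiM {1..n} (\<lambda>_. U)). \<not> rule2_excluded n p i}
    \<le> no_clean_pair_bound n l h r t + 8 * r / l"
proof -
  interpret prob_space U unfolding U_def using l by (rule prob_space_uniform_square)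
  interpret P: product_prob_space "\<lambda>_. U" "{1..n}"
    by (intro product_prob_spaceI) (rule prob_space_axioms)
  define J where "J = {1..n} - {i}"
  interpret PJ: product_prob_space "\<lambda>_. U" J
    by (intro product_prob_spaceI) (rule prob_space_axioms)
  let ?b = "no_clean_pair_bound n l h r t"
  let ?Q = "{2*r..l-2*r} \<times> {2*r..l-2*r}"
  define N where "N = {p \<in> space (PiM {1..n} (\<lambda>_. U)). \<not> rule2_excluded n p i}"
  have setsU [simp]: "sets U = sets borel" by (simp add: U_def)
  have ins: "insert i J = {1..n}" "i \<notin> J" "finite J" using i by (auto simp: J_def)
  have "Measurable.pred (PiM {1..n} (\<lambda>_. U)) (\<lambda>p. rule2_excluded n p i)"
    using i by (intro pred_rule2_excluded) auto
  then have mN: "N \<in> P.events" by (simp add: N_def)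
  have Q: "- ?Q \<in> sets U" by (simp add: borel_comp)
  have "emeasure (PiM {1..n} (\<lambda>_. U)) N = (\<integral>\<^sup>+ p. indicator N p \<partial>PiM (insert i J) (\<lambda>_. U))"
    using mN by (simp add: ins)
  also have "\<dots> = (\<integral>\<^sup>+ x. (\<integral>\<^sup>+ p. indicator N (p(i := x)) \<partial>PiM J (\<lambda>_. U)) \<partial>U)"
    using mN ins by (intro P.product_nn_integral_insert_rev) auto
  also have "\<dots> \<le> (\<integral>\<^sup>+ x. ennreal ?b + indicator (- ?Q) x \<partial>U)"
  proof (rule nn_integral_mono)
    fix x
    show "(\<integral>\<^sup>+ p. indicator N (p(i := x)) \<partial>PiM J (\<lambda>_. U)) \<le> ennreal ?b + indicator (- ?Q) x"
    proof (cases "x \<in> ?Q")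
      case True
      have "(\<integral>\<^sup>+ p. indicator N (p(i := x)) \<partial>PiM J (\<lambda>_. U))
        \<le> (\<integral>\<^sup>+ p. indicator {p. \<not> rule2_excluded n (p(i := x)) i} p \<partial>PiM J (\<lambda>_. U))"
        by (intro nn_integral_mono) (auto simp: indicator_def N_def)
      also have "\<dots> \<le> ennreal ?b"
        unfolding J_def U_def using r l t h i True
        by (intro prob_not_excluded_given_position_le) (auto simp: Y_def)
      finally show ?thesis using True by simp
    next
      case False
      have "(\<integral>\<^sup>+ p. indicator N (p(i := x)) \<partial>PiM J (\<lambda>_. U)) \<le> (\<integral>\<^sup>+ p. 1 \<partial>PiM J (\<lambda>_. U))"
        by (intro nn_integral_mono) (auto simp: indicator_def)
      also have "\<dots> = 1" by (simp add: PJ.emeasure_space_1)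
      finally show ?thesis using False by (simp add: add_increasing)
    qed
  qed
  also have "\<dots> = ennreal ?b + emeasure U (- ?Q)"
    using Q by (subst nn_integral_add) (auto simp: emeasure_space_1 intro!: borel_measurable_indicator)
  also have "\<dots> \<le> ennreal ?b + ennreal (8 * r / l)"
    using prob_near_edge_le[of r l] r l unfolding emeasure_eq_measure
    by (intro add_left_mono ennreal_leI) (simp add: U_def)
  also have "\<dots> = ennreal (?b + 8 * r / l)"
    using r l by (simp add: no_clean_pair_bound_nonneg)
  finally show ?thesis
    using r l no_clean_pair_bound_nonneg[of r n l h t] unfolding N_def[symmetric] P.emeasure_eq_measure
    by (subst (asm) ennreal_le_iff) auto
qed

section \<open>From one vertex to the expectation\<close>

lemma expectation_num_excluded_ge:
  fixes r l :: real and n h t :: nat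
  defines "Y \<equiv> 5 * r * (t * t)"
  assumes iid: "iid_uniform_points M n l V"
    and r: "0 < r" "Y \<le> 1/100" "30 * Y ^ 3 \<le> r" "4 * r \<le> l" and l: "0 < l" and t: "1 \<le> t" and h: "1 \<le> h"
    and n: "2 * h \<le> n"
  shows "real (n - 2 * h) * (1 - (no_clean_pair_bound n l h r t + 8 * r / l))
    \<le> (\<integral>\<omega>. real (num_excluded n (\<lambda>i. V i \<omega>)) \<partial>M)"
proof -
  let ?U = "uniform_measure lborel (square l)"
  let ?P = "PiM {1..n} (\<lambda>_. ?U)"
  let ?b = "no_clean_pair_bound n l h r t + 8 * r / l"
  interpret prob_space M using iid by (simp add: iid_uniform_points_def)
  have ind: "indep_vars (\<lambda>_. borel) V {1..n}"
    and dV: "\<And>i. i \<in> {1..n} \<Longrightarrow> distr M borel (V i) = ?U"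
    using iid by (auto simp: iid_uniform_points_def)
  have rv: "V i \<in> borel_measurable M" if "i \<in> {1..n}" for i
    using ind that by (auto simp: indep_vars_def)
  have "{1..n} \<noteq> {}" using n h by auto
  \<comment> \<open>Independence identifies the joint law of the positions with the product measure,
    so the expectation can be computed there.\<close>
  from iffD1[OF indep_vars_iff_distr_eq_PiM'[OF this rv] ind]
  have "distr M (PiM {1..n} (\<lambda>_. borel)) (\<lambda>\<omega>. \<lambda>i\<in>{1..n}. V i \<omega>) = PiM {1..n} (\<lambda>i. distr M borel (V i))"
    by simp
  also have "\<dots> = ?P" using dV by (intro PiM_cong) auto
  finally have dist: "distr M (PiM {1..n} (\<lambda>_. borel)) (\<lambda>\<omega>. \<lambda>i\<in>{1..n}. V i \<omega>) = ?P" .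
  interpret U: prob_space ?U using l by (rule prob_space_uniform_square)
  interpret P: product_prob_space "\<lambda>_. ?U" "{1..n}"
    by (intro product_prob_spaceI) (rule U.prob_space_axioms)
  define E where "E i = {p \<in> space ?P. rule2_excluded n p i}" for i
  have mE: "E i \<in> P.events" if "i \<in> {1..n}" for i
    using pred_rule2_excluded[of ?U i n] that by (simp add: E_def)
  have int: "integrable ?P (indicat_real (E i))" if "i \<in> {1..n}" for i
    by (rule integrable_real_indicator[OF mE[OF that]]) (simp only: P.emeasure_eq_measure, simp)
  have num: "real (num_excluded n p) = (\<Sum>i\<in>{1..n}. indicator (E i) p)" if "p \<in> space ?P" for p
    using that by (simp add: num_excluded_def E_def indicator_def sum.If_cases Int_def)
  have meas: "(\<lambda>p. real (num_excluded n p)) \<in> borel_measurable ?P"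
    by (subst measurable_cong[OF num]) (use mE in auto)
  have meas': "(\<lambda>p. real (num_excluded n p)) \<in> borel_measurable (PiM {1..n} (\<lambda>_. borel))"
    using meas unfolding dist[symmetric] by simp
  have "(\<integral>\<omega>. real (num_excluded n (\<lambda>i. V i \<omega>)) \<partial>M)
      = (\<integral>\<omega>. real (num_excluded n (\<lambda>i\<in>{1..n}. V i \<omega>)) \<partial>M)"
    by (intro Bochner_Integration.integral_cong refl arg_cong[where f = real] num_excluded_cong) auto
  also have "\<dots> = (\<integral>p. real (num_excluded n p) \<partial>?P)"
    unfolding dist[symmetric]
    by (rule integral_distr[symmetric, OF _ meas']) (auto intro!: measurable_restrict rv)
  also have "\<dots> = (\<integral>p. (\<Sum>i\<in>{1..n}. indicator (E i) p) \<partial>?P)"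
    using num by (intro Bochner_Integration.integral_cong) auto
  also have "\<dots> = (\<Sum>i\<in>{1..n}. P.prob (E i))"
    using int mE by (simp only: Bochner_Integration.integral_sum integral_indicator) (intro sum.cong, auto)
  \<comment> \<open>The last \<open>2 * h\<close> vertices serve as candidates for covering the
    others; their own nonnegative contributions are dropped.\<close>
  also have "\<dots> \<ge> (\<Sum>i\<in>{1..n - 2*h}. P.prob (E i))"
    by (intro sum_mono2) auto
  also have "(\<Sum>i\<in>{1..n - 2*h}. P.prob (E i)) \<ge> (\<Sum>i\<in>{1..n - 2*h}. 1 - ?b)"
  proof (rule sum_mono)
    fix i assume i: "i \<in> {1..n - 2*h}"
    then have i': "1 \<le> i" "i + 2 * h \<le> n" "i \<in> {1..n}" using n by auto
    have "P.prob {p \<in> space ?P. \<not> rule2_excluded n p i} \<le> ?b"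
      using r l t h i' by (intro prob_not_excluded_le) (auto simp: Y_def)
    moreover have "{p \<in> space ?P. \<not> rule2_excluded n p i} = space ?P - E i" by (auto simp: E_def)
    ultimately show "1 - ?b \<le> P.prob (E i)"
      using P.prob_compl[OF mE[OF i'(3)]] by simp
  qed
  finally show ?thesis by simp
qed

subsection \<open>Choice of the parameters\<close>

text \<open>Raise \<open>x \<le> exp x\<close> at \<open>x = 1 / (7 * e)\<close> to the 7th power.
  The exponent 7 leaves one factor \<epsilon> after multiplication by \<open>t\<close>, which is of
  order \<open>1 / \<epsilon> ^ 6\<close>.\<close>

lemma exp_minus_inverse_le:
  fixes e :: real
  assumes "0 < e"
  shows "exp (- (1 / e)) \<le> 7 ^ 7 * e ^ 7"
proof -
  have "1 / (7 * e) \<le> exp (1 / (7 * e))"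
    using exp_ge_add_one_self[of "1 / (7 * e)"] by linarith
  then have "(1 / (7 * e)) ^ 7 \<le> exp (1 / (7 * e)) ^ 7"
    using assms by (intro power_mono) auto
  also have "\<dots> = exp (1 / e)"
    using exp_of_nat_mult[of 7 "1 / (7 * e)"] assms by simp
  finally have "inverse (exp (1 / e)) \<le> inverse ((1 / (7 * e)) ^ 7)"
    using assms by (intro le_imp_inverse_le) auto
  then show ?thesis
    by (simp add: exp_minus field_simps power_mult_distrib)
qed

text \<open>The expected number of hits \<open>h * p\<close> of a slab lies between \<epsilon> ^ 5
  and 2 * \<epsilon> ^ 5, so \<open>t\<close> slabs receive at least 1 / \<epsilon> on average and
  the exponentials are tiny. The last summand is of order \<epsilon> ^ (-12 + 10 + 4), with constant
  4 * 4 * 160 = 2560.\<close>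

lemma no_clean_pair_bound_le:
  fixes \<epsilon> l r :: real
  assumes e: "0 < \<epsilon>" "\<epsilon> \<le> 1" and n: "0 < n" and l: "0 < l" and r: "r ^ 3 = \<epsilon> ^ 4 * l\<^sup>2 / n"
    and h: "\<epsilon> * n \<le> h" "h \<le> 2 * (\<epsilon> * n)" and t: "1 / \<epsilon> ^ 6 \<le> t" "t \<le> 2 / \<epsilon> ^ 6"
  shows "no_clean_pair_bound n l h r t \<le> (3 * 7 ^ 7 + 2560) * \<epsilon>"
proof -
  have p: "r^3 / l\<^sup>2 = \<epsilon> ^ 4 / n" using l r by simp
  have hp: "\<epsilon> ^ 5 \<le> h * (r^3 / l\<^sup>2)" "h * (r^3 / l\<^sup>2) \<le> 2 * \<epsilon> ^ 5"
  proof -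
    have "\<epsilon> * n * (\<epsilon> ^ 4 / n) \<le> h * (\<epsilon> ^ 4 / n)" using e h by (intro mult_right_mono) auto
    then show "\<epsilon> ^ 5 \<le> h * (r^3 / l\<^sup>2)" using n unfolding p by (simp add: power_numeral_reduce field_simps)
    have "h * (\<epsilon> ^ 4 / n) \<le> 2 * (\<epsilon> * n) * (\<epsilon> ^ 4 / n)" using e h by (intro mult_right_mono) auto
    then show "h * (r^3 / l\<^sup>2) \<le> 2 * \<epsilon> ^ 5" using n unfolding p by (simp add: power_numeral_reduce field_simps)
  qed
  have "1 / \<epsilon> ^ 6 * \<epsilon> ^ 5 \<le> t * (h * (r^3 / l\<^sup>2))"
    using t hp e by (intro mult_mono) auto
  also have "\<dots> = h * (t * (r^3 / l\<^sup>2))" by simp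
  also have "1 / \<epsilon> ^ 6 * \<epsilon> ^ 5 = 1 / \<epsilon>" using e by (simp add: power_numeral_reduce field_simps)
  finally have "exp (- (h * (t * (r^3 / l\<^sup>2)))) \<le> exp (- (1 / \<epsilon>))" by simp
  also have "\<dots> \<le> 7 ^ 7 * \<epsilon> ^ 7" using e(1) by (rule exp_minus_inverse_le)
  finally have E: "exp (- (h * (t * (r^3 / l\<^sup>2)))) \<le> 7 ^ 7 * \<epsilon> ^ 7" .
  have "t * exp (- (h * (t * (r^3 / l\<^sup>2)))) \<le> 2 / \<epsilon> ^ 6 * (7 ^ 7 * \<epsilon> ^ 7)"
    using t E e by (intro mult_mono) auto
  also have "\<dots> = 2 * 7 ^ 7 * \<epsilon>" using e by (simp add: power_numeral_reduce field_simps)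
  finally have b1: "t * exp (- (h * (t * (r^3 / l\<^sup>2)))) \<le> 2 * 7 ^ 7 * \<epsilon>" .
  have "\<epsilon> ^ 7 \<le> \<epsilon> ^ 1" using e by (intro power_decreasing) auto
  then have b2: "exp (- (h * (t * (r^3 / l\<^sup>2)))) \<le> 7 ^ 7 * \<epsilon>" using E by simp
  have nb: "n * (160 * r^3 / l\<^sup>2) = 160 * \<epsilon> ^ 4"
    using n l r by simp
  have "real t * real t \<le> 2 / \<epsilon> ^ 6 * (2 / \<epsilon> ^ 6)" using t e by (intro mult_mono) auto
  moreover have "0 \<le> h * (r^3 / l\<^sup>2)" using e order_trans[OF _ hp(1), of 0] by simp
  then have "(h * (r^3 / l\<^sup>2))\<^sup>2 \<le> (2 * \<epsilon> ^ 5)\<^sup>2" by (rule power_mono[OF hp(2)])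
  ultimately have "(real t * real t) * (h * (r^3 / l\<^sup>2))\<^sup>2 \<le> (2 / \<epsilon> ^ 6 * (2 / \<epsilon> ^ 6)) * (2 * \<epsilon> ^ 5)\<^sup>2"
    by (rule mult_mono) (use e in auto)
  then have "(t * t) * (h * (r^3 / l\<^sup>2))\<^sup>2 * (n * (160 * r^3 / l\<^sup>2))
      \<le> (2 / \<epsilon> ^ 6 * (2 / \<epsilon> ^ 6)) * (2 * \<epsilon> ^ 5)\<^sup>2 * (160 * \<epsilon> ^ 4)"
    unfolding nb of_nat_mult using e by (intro mult_right_mono) auto
  also have "\<dots> = 2560 * \<epsilon> ^ 2" using e by (simp add: power_numeral_reduce field_simps)
  also have "\<epsilon> ^ 2 \<le> \<epsilon> ^ 1" using e by (intro power_decreasing) auto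
  finally have b3: "(t * t) * (h * (r^3 / l\<^sup>2))\<^sup>2 * (n * (160 * r^3 / l\<^sup>2)) \<le> 2560 * \<epsilon>" by simp
  show ?thesis using b1 b2 b3 unfolding no_clean_pair_bound_def by (simp add: algebra_simps)
qed

lemma expectation_num_excluded_ge_linear:
  fixes \<alpha> l :: real and n :: nat
  assumes iid: "iid_uniform_points M n l V" and l: "1 \<le> l" and \<alpha>: "1 \<le> \<alpha>" "100 * \<alpha> \<le> n"
    and dense: "1 \<le> \<alpha> / l\<^sup>2 * (\<alpha> / n) ^ 55"
  shows "real n - (3 * 7 ^ 7 + 2572) * \<alpha> \<le> (\<integral>\<omega>. real (num_excluded n (\<lambda>i. V i \<omega>)) \<partial>M)"
proof -
  \<comment> \<open>\<open>r\<close> is chosen so that the expected number of vertices in \<open>caps\<close> is of order \<open>\<epsilon> ^ 4\<close>; a slab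
    then has about \<open>\<epsilon> ^ 5\<close> of the last \<open>h\<close> vertices, so some of \<open>t \<approx> \<epsilon> powi (- 6)\<close> slabs are very likely hit.\<close>
  define \<epsilon> where "\<epsilon> = \<alpha> / n"
  define h where "h = nat \<lceil>\<alpha>\<rceil>"
  define t where "t = nat \<lceil>1 / \<epsilon> ^ 6\<rceil>"
  define r where "r = root 3 (\<epsilon> ^ 4 * l\<^sup>2 / n)"
  have n: "0 < n" using \<alpha> by (cases n) auto
  have e: "0 < \<epsilon>" "\<epsilon> \<le> 1/100" "\<epsilon> * n = \<alpha>" using \<alpha> n by (auto simp: \<epsilon>_def field_simps)
  have h: "\<alpha> \<le> h" "h \<le> 2 * \<alpha>" "1 \<le> h" using \<alpha> unfolding h_def by linarith+
  have "\<epsilon> ^ 6 \<le> 1" using e by (intro power_le_one) auto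
  then have e6: "1 \<le> 1 / \<epsilon> ^ 6" using e by simp
  then have t: "1 / \<epsilon> ^ 6 \<le> t" "t \<le> 1 / \<epsilon> ^ 6 + 1 / \<epsilon> ^ 6" "1 \<le> t"
    unfolding t_def by linarith+
  have r3: "r ^ 3 = \<epsilon> ^ 4 * l\<^sup>2 / n" using e l by (simp add: r_def odd_real_root_pow)
  have r0: "0 < r" using e l n by (simp add: r_def)
  \<comment> \<open>Since \<epsilon> * n = \<alpha>, \<open>dense\<close> says that
    \<open>l\<^sup>2 / n\<close> is at most \<epsilon> ^ 56. With the factor \<epsilon> ^ 4 in
    \<open>r ^ 3\<close> this is the exponent 60 = 3 * 20.\<close>
  have rs: "r \<le> \<epsilon> ^ 20"
  proof -
    have "1 \<le> (\<epsilon> * n / l\<^sup>2) * \<epsilon> ^ 55" unfolding e(3) using dense by (simp add: \<epsilon>_def)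
    moreover have e56: "\<epsilon> ^ 56 = \<epsilon> * \<epsilon> ^ 55" using power_Suc[of \<epsilon> 55] by simp
    ultimately have "l\<^sup>2 / n \<le> \<epsilon> ^ 56" unfolding e56 using n l by (simp add: field_simps)
    then have "\<epsilon> ^ 4 * (l\<^sup>2 / n) \<le> \<epsilon> ^ 4 * \<epsilon> ^ 56" using e by (intro mult_left_mono) auto
    also have "\<epsilon> ^ 4 * \<epsilon> ^ 56 = (\<epsilon> ^ 20) ^ 3" by (simp add: power_add[symmetric] power_mult[symmetric])
    finally have "r ^ 3 \<le> (\<epsilon> ^ 20) ^ 3" using r3 by simp
    then show ?thesis using e r0 by (subst (asm) power_mono_iff) auto
  qed
  let ?Y = "5 * r * (t * t)"
  have "real t * real t \<le> (2 / \<epsilon> ^ 6) * (2 / \<epsilon> ^ 6)" using t e by (intro mult_mono) auto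
  then have "?Y \<le> 5 * r * ((2 / \<epsilon> ^ 6) * (2 / \<epsilon> ^ 6))" using r0 by (intro mult_left_mono) auto
  then have Y1: "?Y \<le> 20 * r / \<epsilon> ^ 12" by (simp add: power_add[symmetric])
  have e1: "\<epsilon> ^ k \<le> (1/100) ^ k" for k using e by (intro power_mono) auto
  have "20 * r / \<epsilon> ^ 12 \<le> 20 * \<epsilon> ^ 20 / \<epsilon> ^ 12" using rs e by (intro divide_right_mono) auto
  also have "\<dots> = 20 * \<epsilon> ^ 8" using e by (simp add: power_diff[of \<epsilon> 12 20, symmetric] field_simps)
  also have "\<dots> \<le> 1 / 100" using e1[of 8] by (simp add: power_numeral_reduce)
  finally have Y2: "?Y \<le> 1/100" using Y1 by simp
  \<comment> \<open>\<open>Y ^ 3\<close> is of order \<open>r ^ 3 / \<epsilon> ^ 36\<close>, so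
    beyond one factor \<open>r\<close> a bound on \<open>r\<^sup>2 / \<epsilon> ^ 36\<close> is
    needed. The exponent 20 leaves \<epsilon> ^ 4 there, enough to absorb the constants.\<close>
  have Y3: "30 * ?Y ^ 3 \<le> r"
  proof -
    have "?Y ^ 3 \<le> (20 * r / \<epsilon> ^ 12) ^ 3" using Y1 r0 by (intro power_mono) auto
    also have "\<dots> = 8000 * r * r\<^sup>2 / \<epsilon> ^ 36"
      by (simp add: power_divide power_mult_distrib power_mult[symmetric] power2_eq_square power3_eq_cube)
    also have "\<dots> \<le> 8000 * r * (\<epsilon> ^ 20)\<^sup>2 / \<epsilon> ^ 36"
      using rs r0 e by (intro divide_right_mono mult_left_mono power_mono) auto
    also have "\<dots> = 8000 * r * \<epsilon> ^ 4"
      using e by (simp add: power_mult[symmetric] power_diff[of \<epsilon> 36 40, symmetric] field_simps)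
    also have "\<dots> \<le> 8000 * r * (1/100) ^ 4"
      using r0 e1[of 4] by (intro mult_left_mono) auto
    finally show ?thesis using r0 by (simp add: power_numeral_reduce)
  qed
  have "\<epsilon> ^ 20 \<le> \<epsilon> ^ 1" using e by (intro power_decreasing) auto
  then have re: "r \<le> \<epsilon>" using rs by simp
  let ?b = "no_clean_pair_bound n l h r t + 8 * r / l"
  have "8 * r / l \<le> 8 * r / 1" using l r0 by (intro divide_left_mono) auto
  moreover have "no_clean_pair_bound n l h r t \<le> (3 * 7 ^ 7 + 2560) * \<epsilon>"
    using e n l r3 h t by (intro no_clean_pair_bound_le) auto
  \<comment> \<open>2568 is 2560 plus 8 for the boundary strip; the final 2572 adds 4 for the at
    most 4 * \<alpha> dropped vertices.\<close>
  ultimately have b: "?b \<le> (3 * 7 ^ 7 + 2568) * \<epsilon>" using re by simp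
  have b0: "0 \<le> ?b" using r0 l no_clean_pair_bound_nonneg[of r n l h t] by simp
  have "2 * real h \<le> real n" using h \<alpha> by linarith
  then have hn: "2 * h \<le> n" by linarith
  have "real (n - 2 * h) * (1 - ?b) \<le> (\<integral>\<omega>. real (num_excluded n (\<lambda>i. V i \<omega>)) \<partial>M)"
    using r0 Y2 Y3 re e l t h hn by (intro expectation_num_excluded_ge[OF iid]) auto
  moreover have "real (n - 2 * h) * ?b \<le> n * ((3 * 7 ^ 7 + 2568) * \<epsilon>)"
    using b b0 by (intro mult_mono) auto
  moreover have "n * ((3 * 7 ^ 7 + 2568) * \<epsilon>) = (3 * 7 ^ 7 + 2568) * \<alpha>" using e(3) by (simp add: mult.commute)
  moreover have "real (n - 2 * h) \<ge> n - 4 * \<alpha>" using h hn by simp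
  ultimately show ?thesis by (simp add: algebra_simps)
qed

theorem theorem5:
  fixes l \<alpha> \<xi> :: "nat \<Rightarrow> real" and c :: real
    and M :: "nat \<Rightarrow> 'a measure"
    and V :: "nat \<Rightarrow> nat \<Rightarrow> 'a \<Rightarrow> real \<times> real"
  assumes "mono_on {1..} l"
    and "c > 0"
    and "\<And>n. n > 1 \<Longrightarrow> ln (real n) \<le> l n \<and> l n \<le> c * sqrt (real n / ln (real n))"
    and "\<alpha> \<in> o(\<lambda>n. real n)"
    and "\<And>n. \<xi> n = \<alpha> n / (l n)\<^sup>2"
    and "filterlim \<xi> at_top sequentially"
    and "\<forall>\<^sub>F n in sequentially. 16 * real n / ln (\<xi> n) powr (3/2) < \<alpha> n"
    and "\<And>n. n > 1 \<Longrightarrow> iid_uniform_points (M n) n (l n) (V n)"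
  shows "\<exists>g \<in> O(\<alpha>). \<forall>\<^sub>F n in sequentially.
    (\<integral>\<omega>. real (num_excluded n (\<lambda>i. V n i \<omega>)) \<partial>M n) \<ge> real n - g n"
proof (rule bexI)
  show "(\<lambda>n. (3 * 7 ^ 7 + 2572) * \<alpha> n) \<in> O(\<alpha>)" by simp
  have "\<forall>\<^sub>F n in sequentially. norm (\<alpha> n) \<le> 1/100 * norm (real n)"
    using assms(4) by (rule landau_o.smallD) simp
  \<comment> \<open>The exponent is 110 = 2 * 55: below, n / \<alpha> is bounded by the square of
    the logarithm of \<xi>, and its 55th power must not exceed \<xi>.\<close>
  moreover have "\<forall>\<^sub>F x::real in at_top. ln x ^ 110 \<le> x \<and> 1 \<le> ln x \<and> 1 \<le> x"
    by (intro eventually_conj; real_asymp)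
  then have "\<forall>\<^sub>F n in sequentially. ln (\<xi> n) ^ 110 \<le> \<xi> n \<and> 1 \<le> ln (\<xi> n) \<and> 1 \<le> \<xi> n"
    using assms(6) by (rule eventually_compose_filterlim)
  moreover have "\<forall>\<^sub>F n in sequentially. 1 \<le> ln (real n)" by real_asymp
  moreover have "\<forall>\<^sub>F n::nat in sequentially. n > 1" by (rule eventually_gt_at_top)
  ultimately show "\<forall>\<^sub>F n in sequentially.
    (\<integral>\<omega>. real (num_excluded n (\<lambda>i. V n i \<omega>)) \<partial>M n) \<ge> real n - (3 * 7 ^ 7 + 2572) * \<alpha> n"
    using assms(7)
  proof eventually_elim
    case (elim n)
    have l: "1 \<le> l n" using elim(3,4) assms(3)[of n] by linarith
    have \<alpha>: "\<alpha> n = \<xi> n * (l n)\<^sup>2" using l by (simp add: assms(5))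
    have "1 * 1 \<le> \<xi> n * (l n)\<^sup>2" using elim(2) l by (intro mult_mono) auto
    then have \<alpha>1: "1 \<le> \<alpha> n" by (simp add: \<alpha>)
    have n: "0 < real n" using elim(4) by simp
    have L: "1 \<le> ln (\<xi> n)" using elim(2) by simp
    \<comment> \<open>Hypothesis (iii), with the exponent 3/2 raised to the integer 2 (allowed as
      the logarithm is at least 1) and the factor 16 given away.\<close>
    have "1 / ln (\<xi> n) ^ 2 \<le> \<alpha> n / n"
    proof -
      have "ln (\<xi> n) powr (3/2) \<le> ln (\<xi> n) powr 2" using L by (intro powr_mono) auto
      also have "\<dots> = ln (\<xi> n) ^ 2" using L by simp
      finally have "16 * real n / ln (\<xi> n) ^ 2 \<le> 16 * real n / ln (\<xi> n) powr (3/2)"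
        using L by (intro divide_left_mono) auto
      then have "16 * real n / ln (\<xi> n) ^ 2 \<le> \<alpha> n" using elim(5) by simp
      moreover have "1 * real n / ln (\<xi> n) ^ 2 \<le> 16 * real n / ln (\<xi> n) ^ 2"
        by (intro divide_right_mono) auto
      ultimately have "real n / ln (\<xi> n) ^ 2 \<le> \<alpha> n" by simp
      then show ?thesis using n by (simp add: field_simps)
    qed
    then have "(1 / ln (\<xi> n) ^ 2) ^ 55 \<le> (\<alpha> n / n) ^ 55" by (intro power_mono) auto
    then have "ln (\<xi> n) ^ 110 * (1 / ln (\<xi> n) ^ 2) ^ 55 \<le> \<xi> n * (\<alpha> n / n) ^ 55"
      using elim(2) by (intro mult_mono) auto
    also have "ln (\<xi> n) ^ 110 * (1 / ln (\<xi> n) ^ 2) ^ 55 = 1"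
      using L by (simp add: power_one_over power_mult[symmetric] field_simps)
    finally have "1 \<le> \<alpha> n / (l n)\<^sup>2 * (\<alpha> n / n) ^ 55" by (simp add: assms(5))
    then show ?case
      using elim(1,4) \<alpha>1 l assms(8)[of n]
      by (intro expectation_num_excluded_ge_linear[where l = "l n"]) auto
  qed
qed

end
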